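(* Let $\alpha\ge 1$ be an integer. For the monodromy tree of $(\sigma_0,\sigma_1,s_1)$, represented in types I–V as in the context, the following hold. (Memory.) The number of bits, in excess of $\rho(\sigma)$, needed to store the representation is given below, followed by its expected value (for $\sigma_0$ uniformly random in $\mathfrak S_{\Omega_{\mathbf u}}\cong\mathfrak S_d$) and the asymptotic order of that expected value: - Type I: $\rho(\mathbb C^n)$; expectation $\rho(\mathbb C^n)$; order $\mathcal O(n)$. - Type II: $\rho(\mathbb C^n)+(r-1)\rho(\mathbb N)$; expectation $\rho(\mathbb C^n)+(H_d-1)\rho(\mathbb N)$; order $\mathcal O(\max(n,\ln d))$. - Type III: $\rho(\mathbb C^n)+(2r-1)\rho(\mathbb N)$; expectation $\rho(\mathbb C^n)+(2H_d-1)\rho(\mathbb N)$; order $\mathcal O(\max(n,\ln d))$. - Type IV: $r\,\rho(\mathbb C^n)+(2r-1)\rho(\mathbb N)$; expectation $H_d\,\rho(\mathbb C^n)+(2H_d-1)\rho(\mathbb N)$; order $\mathcal O(n\ln d)$. - Type V: $\left(\sum_{i=1}^r\lceil m_i/\alpha\rceil\right)\rho(\mathbb C^n)+(2r-1)\rho(\mathbb N)$; expectation strictly less than $\left(\frac d\alpha+H_d\right)\rho(\mathbb C^n)+(2H_d-1)\rho(\mathbb N)$; order $\mathcal O(\max(n(d/\alpha),\,n\ln d))$. (Time.) The number of oracle queries needed to unpack all of $\Omega_{\mathbf u}$ from the representation, by the unpacking procedures in the context, is $\mathcal O(d)$ in each case, and is equal to - Type I: $d+j^*-1$; - Type II: $d+r-2$;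 - Type III: $d-1$; - Type IV: $d-r$; - Type V: $d-\sum_{i=1}^r\lceil m_i/\alpha\rceil$.
   Context: Setting. $\Omega_{\mathbf u}\subset\mathbb C^n$ is the $d$-element solution set of a polynomial system $F(\mathbf x;\mathbf u)=0$ at a regular parameter value $\mathbf u$ (a fibre of a degree-$d$ branched cover $X\to Y$, where $X=\{F(\mathbf x;\mathbf p)=0\}\subseteq\mathbb C^n\times\mathbb C^k$ is irreducible and $Y$ is the closure of its projection to $\mathbb C^k$). $s_1\in\Omega_{\mathbf u}$ is a seed solution, and $\sigma_0,\sigma_1\in\mathfrak S_{\Omega_{\mathbf u}}$ generate a group acting transitively on $\Omega_{\mathbf u}$. "Strong monodromy assumptions": the monodromy group is all of $\mathfrak S_{\Omega_{\mathbf u}}\cong\mathfrak S_d$; its elements can be sampled uniformly at random; and given $\sigma_i$ and $s$, an evaluation oracle returns $\sigma_i(s)$, each evaluation counting as one query. $\sigma$ denotes the pair of oracles for $\sigma_0,\sigma_1$. Algorithm MonodromySolve. $S$ is an ordered list, and a point is "new" if it is not in $S$. Start with $S=(s_1)$ and $j=1$; write $s_i$ for the $i$-th element of $S$. While $|S|<d$: query $q:=\sigma_0(\mathrm{last}(S))$. If $q$ is new, append it to $S$. Otherwise query $q:=\sigma_1(s_j)$; as long as $q$ is not new, replace $j$ by $j+1$ and query $q:=\sigma_1(s_j)$ again; once $q$ is new, call the current $j$ a founder index, append $q$ to $S$, and replace $j$ by $j+1$. The resulting order $s_1,\dots,s_d$ is the monodromy ordering of $\Omega_{\mathbf u}$;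 each cycle of $\sigma_0$ occupies consecutive positions and is traversed by $\sigma_0$. Notation. $r$ is the number of cycles of $\sigma_0$ (including fixed points). $\mathcal C=(c_1,\dots,c_r)$ are the minimal elements, in the monodromy ordering, of the cycles of $\sigma_0$, listed in that order. $M=(m_1,\dots,m_r)$ are the corresponding cycle lengths. $\mathcal F$ is the increasing list of the $r-1$ founder indices, and $j^*=\max\mathcal F$ (with $j^*=0$ if $\mathcal F=\emptyset$). $\mathcal C_\alpha$ consists, for each cycle $i$, of $c_i$ together with every $\alpha$-th solution in the cycle, i.e. $c_i,\sigma_0^{\alpha}(c_i),\sigma_0^{2\alpha}(c_i),\dots$, giving $\lceil m_i/\alpha\rceil$ points of cycle $i$. $H_d=\sum_{i=1}^d\frac1i$. The monodromy tree is the rooted binary tree on $\{1,\dots,d\}$ with root $1$ in which $j\to j'$ is an edge labelled $0$ (resp. $1$) if $s_{j'}$ was first found as $\sigma_0(s_j)$ (resp. $\sigma_1(s_j)$). Its representations are: type I $(s_1,\sigma)$; type II $(s_1,\sigma,\mathcal F)$; type III $(s_1,\sigma,\mathcal F,M)$; type IV $(\mathcal C,\sigma,\mathcal F,M)$; type V $(\mathcal C_\alpha,\sigma,\mathcal F,M)$. Unpacking procedures. Type I: run MonodromySolve. Type II: run MonodromySolve, but replace each search for a new point via $\sigma_1$ by the single query $\sigma_1(s_f)$, where $f$ is the next unused entry of $\mathcal F$. Type III: as type II, but use $M$ to recognise the end of a cycle, so that $\sigma_0$ is never queried at the last element of a cycle. Type IV: as type III, but the first solution of each cycle is read from $\mathcal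 C$, so $\sigma_1$ is never queried. Type V: as type IV, but every solution in $\mathcal C_\alpha$ is read from storage, and only the remaining solutions are computed by queries to $\sigma_0$. Storage. $\rho(\square)$ is the number of bits used to store $\square$; $\rho(\mathbb C^n)=2n\,\rho(\mathbb R)$; $\rho(\mathbb R)$ and $\rho(\mathbb N)$ (the cost of storing one real number, resp. one integer at most $d$) are constants independent of $n,d,\alpha$. Asymptotics are for $d\ge2$. *)

theory Defs
  imports
    "HOL-Probability.Probability"
    "HOL-Combinatorics.Orbits"
    "HOL-Algebra.Generated_Groups"
    "HOL-Library.While_Combinator"
    "Jordan_Normal_Form.Matrix"
begin

section \<open>The monodromy data\<close>

type_synonym 'a oracles = "('a \<Rightarrow> 'a) \<times> ('a \<Rightarrow> 'a)"

definition perm_group :: "'a set \<Rightarrow> ('a \<Rightarrow> 'a) monoid" where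
  "perm_group \<Omega> = \<lparr>carrier = {p. p permutes \<Omega>}, mult = (\<circ>), one = id\<rparr>"

definition generates_transitive_group :: "'a set \<Rightarrow> 'a oracles \<Rightarrow> bool" where
  "generates_transitive_group \<Omega> \<sigma> \<longleftrightarrow>
     (\<forall>x\<in>\<Omega>. \<forall>y\<in>\<Omega>. \<exists>g\<in>generate (perm_group \<Omega>) {fst \<sigma>, snd \<sigma>}. g x = y)"

text \<open>
  The solution set is an arbitrary finite set of points of complex $n$-space.  Under the strong
  monodromy assumptions the monodromy group of a fibre is its full symmetric group, so the two
  permutations range over all permutations of the set.
\<close>

definition monodromy_data ::
    "nat \<Rightarrow> complex Matrix.vec set \<Rightarrow> complex Matrix.vec oracles \<Rightarrow> complex Matrix.vec \<Rightarrow> bool" where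
  "monodromy_data n \<Omega> \<sigma> s \<longleftrightarrow>
     n \<ge> 1 \<and> finite \<Omega> \<and> \<Omega> \<subseteq> carrier_vec n \<and> s \<in> \<Omega> \<and>
     fst \<sigma> permutes \<Omega> \<and> snd \<sigma> permutes \<Omega> \<and> generates_transitive_group \<Omega> \<sigma>"

definition cycles :: "'a set \<Rightarrow> ('a \<Rightarrow> 'a) \<Rightarrow> 'a set set" where
  "cycles \<Omega> p = orbit p ` \<Omega>"


section \<open>MonodromySolve\<close>

record 'a solve_state =
  sols :: "'a list"
  pos :: nat
  searching :: bool
  founders :: "nat list"
  queries :: nat

text \<open>
  Every step makes exactly one oracle query.  The flag \<open>searching\<close> is set while the inner search
  for a new point via the second permutation is in progress.  Positions are counted from 1, so
  \<open>s\<^sub>j\<close> is the list entry with index \<open>j - 1\<close>.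
\<close>

definition solve_step :: "'a oracles \<Rightarrow> 'a solve_state \<Rightarrow> 'a solve_state" where
  "solve_step \<sigma> st =
     (let S = sols st; j = pos st; st' = st\<lparr>queries := queries st + 1\<rparr> in
      if \<not> searching st then
        (let q = fst \<sigma> (last S) in
         if q \<notin> set S then st'\<lparr>sols := S @ [q]\<rparr>
         else st'\<lparr>searching := True\<rparr>)
      else
        (let q = snd \<sigma> (S ! (j - 1)) in
         if q \<notin> set S
         then st'\<lparr>sols := S @ [q], founders := founders st @ [j], pos := j + 1, searching := False\<rparr>
         else st'\<lparr>pos := j + 1\<rparr>))"

definition monodromy_solve :: "nat \<Rightarrow> 'a oracles \<Rightarrow> 'a \<Rightarrow> 'a solve_state option" where
  "monodromy_solve d \<sigma> s =
     while_option (\<lambda>st. length (sols st) < d) (solve_step \<sigma>)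
       \<lparr>sols = [s], pos = 1, searching = False, founders = [], queries = 0\<rparr>"

definition monodromy_ordering :: "nat \<Rightarrow> 'a oracles \<Rightarrow> 'a \<Rightarrow> 'a list" where
  "monodromy_ordering d \<sigma> s = sols (the (monodromy_solve d \<sigma> s))"

definition founder_indices :: "nat \<Rightarrow> 'a oracles \<Rightarrow> 'a \<Rightarrow> nat list" where
  "founder_indices d \<sigma> s = founders (the (monodromy_solve d \<sigma> s))"

definition last_founder :: "nat \<Rightarrow> 'a oracles \<Rightarrow> 'a \<Rightarrow> nat" where
  "last_founder d \<sigma> s =
     (let F = founder_indices d \<sigma> s in if F = [] then 0 else Max (set F))"

definition cycle_minima :: "nat \<Rightarrow> 'a oracles \<Rightarrow> 'a \<Rightarrow> 'a list" where
  "cycle_minima d \<sigma> s =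
     (let S = monodromy_ordering d \<sigma> s in
      [S ! i. i \<leftarrow> [0..<length S], \<forall>k<i. S ! k \<notin> orbit (fst \<sigma>) (S ! i)])"

definition cycle_lengths :: "nat \<Rightarrow> 'a oracles \<Rightarrow> 'a \<Rightarrow> nat list" where
  "cycle_lengths d \<sigma> s = map (\<lambda>c. card (orbit (fst \<sigma>) c)) (cycle_minima d \<sigma> s)"

definition cycle_samples :: "nat \<Rightarrow> nat \<Rightarrow> 'a oracles \<Rightarrow> 'a \<Rightarrow> 'a list" where
  "cycle_samples \<alpha> d \<sigma> s =
     concat (map (\<lambda>c. [(fst \<sigma> ^^ k) c. k \<leftarrow> [0..<card (orbit (fst \<sigma>) c)], \<alpha> dvd k])
       (cycle_minima d \<sigma> s))"


section \<open>Representations of the monodromy tree\<close>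

datatype rep_type = I | II | III | IV | V

datatype 'a representation =
    Rep1 'a "'a oracles"
  | Rep2 'a "'a oracles" "nat list"
  | Rep3 'a "'a oracles" "nat list" "nat list"
  | Rep4 "'a list" "'a oracles" "nat list" "nat list"
  | Rep5 "'a list" "'a oracles" "nat list" "nat list"

fun represent :: "rep_type \<Rightarrow> nat \<Rightarrow> nat \<Rightarrow> 'a oracles \<Rightarrow> 'a \<Rightarrow> 'a representation" where
  "represent I \<alpha> d \<sigma> s = Rep1 s \<sigma>"
| "represent II \<alpha> d \<sigma> s = Rep2 s \<sigma> (founder_indices d \<sigma> s)"
| "represent III \<alpha> d \<sigma> s = Rep3 s \<sigma> (founder_indices d \<sigma> s) (cycle_lengths d \<sigma> s)"
| "represent IV \<alpha> d \<sigma> s =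
     Rep4 (cycle_minima d \<sigma> s) \<sigma> (founder_indices d \<sigma> s) (cycle_lengths d \<sigma> s)"
| "represent V \<alpha> d \<sigma> s =
     Rep5 (cycle_samples \<alpha> d \<sigma> s) \<sigma> (founder_indices d \<sigma> s) (cycle_lengths d \<sigma> s)"


section \<open>Storage\<close>

text \<open>A point of complex $n$-space is stored as \<open>2 * n\<close> real numbers of \<open>\<rho>R\<close> bits each.\<close>

definition point_bits :: "nat \<Rightarrow> nat \<Rightarrow> nat" where
  "point_bits \<rho>R n = 2 * n * \<rho>R"

text \<open>
  \<open>excess_bits pb ib R\<close> is the storage beyond that of the pair of oracles when a point costs \<open>pb\<close>
  bits and an integer costs \<open>ib\<close> bits.
\<close>

fun excess_bits :: "nat \<Rightarrow> nat \<Rightarrow> 'a representation \<Rightarrow> nat" where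
  "excess_bits pb ib (Rep1 s \<sigma>) = pb"
| "excess_bits pb ib (Rep2 s \<sigma> F) = pb + length F * ib"
| "excess_bits pb ib (Rep3 s \<sigma> F M) = pb + length F * ib + length M * ib"
| "excess_bits pb ib (Rep4 C \<sigma> F M) = length C * pb + length F * ib + length M * ib"
| "excess_bits pb ib (Rep5 C \<sigma> F M) = length C * pb + length F * ib + length M * ib"


section \<open>Unpacking\<close>

text \<open>
  In the loop states below, \<open>S\<close> lists the solutions recovered so far, \<open>F\<close>, \<open>M\<close> and \<open>C\<close> are the parts
  of the stored lists not yet consumed (the head of \<open>M\<close> belongs to the current cycle), \<open>t\<close> is the
  number of solutions of the current cycle recovered so far, and \<open>k\<close> counts oracle queries.
\<close>

definition unpack_step2 ::
    "'a oracles \<Rightarrow> 'a list \<times> nat list \<times> nat \<Rightarrow> 'a list \<times> nat list \<times> nat" where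
  "unpack_step2 \<sigma> = (\<lambda>(S, F, k).
     let q = fst \<sigma> (last S) in
     if q \<notin> set S then (S @ [q], F, k + 1)
     else (S @ [snd \<sigma> (S ! (hd F - 1))], tl F, k + 2))"

definition unpack_step3 ::
    "'a oracles \<Rightarrow> 'a list \<times> nat \<times> nat list \<times> nat list \<times> nat
       \<Rightarrow> 'a list \<times> nat \<times> nat list \<times> nat list \<times> nat" where
  "unpack_step3 \<sigma> = (\<lambda>(S, t, M, F, k).
     if t < hd M then (S @ [fst \<sigma> (last S)], t + 1, M, F, k + 1)
     else (S @ [snd \<sigma> (S ! (hd F - 1))], 1, tl M, tl F, k + 1))"

definition unpack_step4 ::
    "'a oracles \<Rightarrow> 'a list \<times> nat \<times> nat list \<times> 'a list \<times> nat
       \<Rightarrow> 'a list \<times> nat \<times> nat list \<times> 'a list \<times> nat" where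
  "unpack_step4 \<sigma> = (\<lambda>(S, t, M, C, k).
     if t < hd M then (S @ [fst \<sigma> (last S)], t + 1, M, C, k + 1)
     else (S @ [hd C], 1, tl M, tl C, k))"

definition unpack_step5 ::
    "nat \<Rightarrow> 'a oracles \<Rightarrow> 'a list \<times> nat \<times> nat list \<times> 'a list \<times> nat
       \<Rightarrow> 'a list \<times> nat \<times> nat list \<times> 'a list \<times> nat" where
  "unpack_step5 \<alpha> \<sigma> = (\<lambda>(S, t, M, C, k).
     if t < hd M then
       (if \<alpha> dvd t then (S @ [hd C], t + 1, M, tl C, k)
        else (S @ [fst \<sigma> (last S)], t + 1, M, C, k + 1))
     else (S @ [hd C], 1, tl M, tl C, k))"

text \<open>The result is the list of recovered solutions together with the number of queries made.\<close>

fun unpack :: "nat \<Rightarrow> nat \<Rightarrow> 'a representation \<Rightarrow> ('a list \<times> nat) option" where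
  "unpack \<alpha> d (Rep1 s \<sigma>) =
     map_option (\<lambda>st. (sols st, queries st)) (monodromy_solve d \<sigma> s)"
| "unpack \<alpha> d (Rep2 s \<sigma> F) =
     map_option (\<lambda>(S, F', k). (S, k))
       (while_option (\<lambda>(S, _). length S < d) (unpack_step2 \<sigma>) ([s], F, 0))"
| "unpack \<alpha> d (Rep3 s \<sigma> F M) =
     map_option (\<lambda>(S, t, M', F', k). (S, k))
       (while_option (\<lambda>(S, _). length S < d) (unpack_step3 \<sigma>) ([s], 1, M, F, 0))"
| "unpack \<alpha> d (Rep4 C \<sigma> F M) =
     map_option (\<lambda>(S, t, M', C', k). (S, k))
       (while_option (\<lambda>(S, _). length S < d) (unpack_step4 \<sigma>) ([hd C], 1, M, tl C, 0))"
| "unpack \<alpha> d (Rep5 C \<sigma> F M) =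
     map_option (\<lambda>(S, t, M', C', k). (S, k))
       (while_option (\<lambda>(S, _). length S < d) (unpack_step5 \<alpha> \<sigma>) ([hd C], 1, M, tl C, 0))"

definition unpack_queries :: "rep_type \<Rightarrow> nat \<Rightarrow> nat \<Rightarrow> 'a oracles \<Rightarrow> 'a \<Rightarrow> nat" where
  "unpack_queries T \<alpha> d \<sigma> s = snd (the (unpack \<alpha> d (represent T \<alpha> d \<sigma> s)))"


section \<open>Random permutations\<close>

definition uniform_perm :: "'a set \<Rightarrow> ('a \<Rightarrow> 'a) pmf" where
  "uniform_perm \<Omega> = pmf_of_set {p. p permutes \<Omega>}"

text \<open>
  The representations only exist when the two permutations generate a transitive group.  Hence the
  expected number of bits is taken over a joint law of the pair whose first component is uniform and
  which satisfies transitivity almost surely.  Such laws exist, e.g. with the second component a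
  fixed cycle through all of \<open>\<Omega>\<close>.
\<close>

definition random_monodromy_data ::
    "nat \<Rightarrow> complex Matrix.vec set \<Rightarrow> complex Matrix.vec oracles pmf \<Rightarrow> complex Matrix.vec \<Rightarrow> bool" where
  "random_monodromy_data n \<Omega> P s \<longleftrightarrow>
     map_pmf fst P = uniform_perm \<Omega> \<and> (\<forall>\<sigma>\<in>set_pmf P. monodromy_data n \<Omega> \<sigma> s)"

definition expected_bits ::
    "nat \<Rightarrow> nat \<Rightarrow> rep_type \<Rightarrow> nat \<Rightarrow> nat \<Rightarrow> 'a set \<Rightarrow> 'a oracles pmf \<Rightarrow> 'a \<Rightarrow> real" where
  "expected_bits \<rho>R \<rho>N T \<alpha> n \<Omega> P s =
     measure_pmf.expectation P
       (\<lambda>\<sigma>. real (excess_bits (point_bits \<rho>R n) \<rho>N (represent T \<alpha> (card \<Omega>) \<sigma> s)))"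

end

theory Submission
  imports Defs
begin

text \<open>
  Starting from the seed, the algorithm walks along a cycle of \<open>\<sigma>\<^sub>0\<close> until it closes, and then looks for
  the first known point whose image under \<open>\<sigma>\<^sub>1\<close> is new.  Since the known points form a union of full
  cycles of \<open>\<sigma>\<^sub>0\<close> at that moment, the new point lies on a cycle not met before, which is walked next.
  If no such point existed, the known points would be closed under both permutations and hence, by
  transitivity, would be the whole fibre.  So the final ordering is the concatenation of the cycles of
  \<open>\<sigma>\<^sub>0\<close>, each traversed from its first point, and each first point except the seed comes from a founder.
  This structure is the predicate \<open>grows\<close>; the lemma \<open>monodromy_solve_terminates\<close> establishes it by an
  invariant of the solver.

  There are \<open>r\<close> cycles and \<open>r - 1\<close> founders, from which all storage formulas follow.  Each of the cheaper
  unpacking procedures recovers the same ordering because its stored data replaces exactly the answers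
  that the solver obtained by extra queries (\<open>unpack2_reaches\<close>, \<open>unpack3_reaches\<close>, \<open>unpack4_reaches\<close>,
  \<open>unpack5_reaches\<close>); the number of queries is the number of points plus the number of queries with a
  known answer, minus the number of points that are stored.

  The storage depends on \<open>\<sigma>\<^sub>0\<close> through the number of cycles and, for type V, through the rounded
  quotients of the cycle lengths.  The expected number of cycles of a uniformly random permutation of
  \<open>d\<close> points is the harmonic number \<open>H\<^sub>d\<close> (\<open>sum_card_cycles\<close>), and rounding adds less than one per cycle.
  With \<open>H\<^sub>d \<le> 1 + ln d\<close> the asymptotic bounds follow, with constants depending only on the cost of a
  real number and of an integer.
\<close>

section \<open>Cycles and walks along cycles\<close>

text \<open>
  The monodromy ordering is made of runs along cycles of \<open>\<sigma>\<^sub>0\<close>; during the solver all runs but the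
  last are complete, so partial runs are needed as well as full ones.
\<close>

definition traverse :: "('a \<Rightarrow> 'a) \<Rightarrow> 'a \<Rightarrow> nat \<Rightarrow> 'a list" where
  "traverse p c k = map (\<lambda>i. (p ^^ i) c) [0..<k]"

abbreviation period :: "('a \<Rightarrow> 'a) \<Rightarrow> 'a \<Rightarrow> nat" where
  "period p c \<equiv> card (orbit p c)"

definition full_cycle :: "('a \<Rightarrow> 'a) \<Rightarrow> 'a \<Rightarrow> 'a list" where
  "full_cycle p c = traverse p c (period p c)"

definition walk :: "('a \<Rightarrow> 'a) \<Rightarrow> 'a list \<Rightarrow> 'a list" where
  "walk p C = concat (map (full_cycle p) C)"

lemma length_traverse [simp]: "length (traverse p c k) = k"
  by (simp add: traverse_def)

lemma traverse_Suc: "traverse p c (Suc k) = traverse p c k @ [(p ^^ k) c]"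
  by (simp add: traverse_def)

lemma traverse_1: "traverse p c (Suc 0) = [c]"
  by (simp add: traverse_def)

lemma last_append_traverse: "0 < k \<Longrightarrow> p (last (xs @ traverse p c k)) = (p ^^ k) c"
  by (cases k) (simp_all add: traverse_Suc)

lemma walk_simps [simp]:
  "walk p [] = []" "walk p (C @ [c]) = walk p C @ full_cycle p c"
  by (simp_all add: walk_def)

lemma walk_single: "walk p [c] = full_cycle p c"
  by (simp add: walk_def)

lemma length_full_cycle [simp]: "length (full_cycle p c) = period p c"
  by (simp add: full_cycle_def)

lemma orbit_eq_of_mem:
  assumes "permutation p" "y \<in> orbit p x"
  shows "orbit p y = orbit p x"
  using cyclic_on_orbit'[OF assms(1)] assms(2) by (rule orbit_cyclic_eq3)

lemma finite_orbit_permutation: "permutation p \<Longrightarrow> finite (orbit p c)"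
  by (simp add: finite_orbit permutation_self_in_orbit)

lemma period_eq_funpow_dist1: 
  assumes "permutation p"
  shows "period p c = funpow_dist1 p c c"
proof -
  have c: "c \<in> orbit p c" using assms by (rule permutation_self_in_orbit)
  show ?thesis
    by (subst orbit_conv_funpow_dist1[OF c], subst card_image[OF inj_on_funpow_dist1[OF c]]) simp
qed

lemma
  assumes "permutation p"
  shows period_pos: "0 < period p c"
    and set_full_cycle: "set (full_cycle p c) = orbit p c"
    and distinct_full_cycle: "distinct (full_cycle p c)"
proof -
  have c: "c \<in> orbit p c" using assms by (rule permutation_self_in_orbit)
  show "0 < period p c" unfolding period_eq_funpow_dist1[OF assms] by simp
  show "set (full_cycle p c) = orbit p c" 
    unfolding full_cycle_def traverse_def period_eq_funpow_dist1[OF assms]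
    using orbit_conv_funpow_dist1[OF c] by (simp only: set_map set_upt)
  show "distinct (full_cycle p c)" 
    unfolding full_cycle_def traverse_def period_eq_funpow_dist1[OF assms]
    using inj_on_funpow_dist1[OF c] by (simp only: distinct_map set_upt distinct_upt simp_thms)
qed

lemma set_walk: "permutation p \<Longrightarrow> set (walk p C) = (\<Union>c\<in>set C. orbit p c)"
  by (simp add: walk_def set_full_cycle)

lemma orbit_subset_walk:
  assumes "permutation p" "x \<in> set (walk p C)"
  shows "orbit p x \<subseteq> set (walk p C)"
  using assms by (auto simp: set_walk dest: orbit_eq_of_mem)

text \<open>
  A list of full cycles is closed under the permutation, so a single point missing from it certifies
  that a whole cycle is missing.  This is why one new point found by \<open>\<sigma>\<^sub>1\<close> opens a new cycle.
\<close>

lemma orbit_disjoint_walk: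
  assumes "permutation p" "c \<notin> set (walk p C)"
  shows "orbit p c \<inter> set (walk p C) = {}"
proof (rule ccontr)
  assume "orbit p c \<inter> set (walk p C) \<noteq> {}"
  then obtain y where y: "y \<in> orbit p c" "y \<in> set (walk p C)" by auto
  have "c \<in> orbit p y"
    using orbit_eq_of_mem[OF assms(1) y(1)] permutation_self_in_orbit[OF assms(1)] by simp
  then show False using orbit_subset_walk[OF assms(1) y(2)] assms(2) by auto
qed

lemma traverse_append_full:
  assumes "k \<le> period p c"
  shows "full_cycle p c = traverse p c k @ drop k (full_cycle p c)"
proof -
  have "take k (full_cycle p c) = traverse p c k"
    using assms by (simp add: full_cycle_def traverse_def take_map)
  then show ?thesis using append_take_drop_id[of k "full_cycle p c"] by simp
qed

text \<open>
  The minima that the representations store are read off a list by comparing each entry with all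
  earlier ones.  The lemmas below recover from a walk the starting points it was built from.
\<close>

definition cycle_firsts :: "('a \<Rightarrow> 'a) \<Rightarrow> 'a list \<Rightarrow> 'a list" where
  "cycle_firsts p S = [S ! i. i \<leftarrow> [0..<length S], \<forall>k<i. S ! k \<notin> orbit p (S ! i)]"

lemma cycle_firsts_Nil [simp]: "cycle_firsts p [] = []"
  by (simp add: cycle_firsts_def)

lemma cycle_firsts_snoc:
  "cycle_firsts p (S @ [x]) = cycle_firsts p S @ (if set S \<inter> orbit p x = {} then [x] else [])"
proof -
  have 1: "(\<forall>k<length S. (S @ [x]) ! k \<notin> orbit p x) \<longleftrightarrow> set S \<inter> orbit p x = {}"
    by (auto simp: set_conv_nth nth_append)
  have 2: "concat (map (\<lambda>i. if \<forall>k<i. (S @ [x]) ! k \<notin> orbit p ((S @ [x]) ! i) then [(S @ [x]) ! i] else [])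
             [0..<length S]) =
           concat (map (\<lambda>i. if \<forall>k<i. S ! k \<notin> orbit p (S ! i) then [S ! i] else []) [0..<length S])"
    by (rule arg_cong[where f = concat], rule map_cong) (auto simp: nth_append)
  show ?thesis
    unfolding cycle_firsts_def using 1 2 by simp
qed

lemma cycle_firsts_traverse:
  assumes p: "permutation p" and "set S \<inter> orbit p c = {}" 
  shows "cycle_firsts p (S @ traverse p c (Suc k)) = cycle_firsts p S @ [c]"
proof (induction k)
  case 0
  then show ?case using assms by (simp add: traverse_1 cycle_firsts_snoc)
next
  case (Suc k)
  have "c \<in> set (S @ traverse p c (Suc k))" by (simp add: traverse_def image_iff del: upt_Suc)
      (rule disjI2, rule bexI[of _ 0], auto)
  moreover have "(p ^^ Suc k) c \<in> orbit p c"
    by (rule funpow_in_orbit[OF permutation_self_in_orbit[OF p]])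
  then have "c \<in> orbit p ((p ^^ Suc k) c)"
    using orbit_eq_of_mem[OF p] permutation_self_in_orbit[OF p] by metis
  ultimately have "set (S @ traverse p c (Suc k)) \<inter> orbit p ((p ^^ Suc k) c) \<noteq> {}" by blast
  then show ?case using Suc
    by (subst traverse_Suc, subst append_assoc[symmetric], subst cycle_firsts_snoc) simp
qed

lemma cycle_firsts_walk:
  assumes p: "permutation p" and "distinct (walk p C)"
  shows "cycle_firsts p (walk p C) = C"
  using assms(2)
proof (induction C rule: rev_induct)
  case (snoc c C)
  then have "set (walk p C) \<inter> orbit p c = {}" by (simp add: set_full_cycle[OF p])
  from cycle_firsts_traverse[OF p this] snoc show ?case
    using period_pos[OF p, of c] by (cases "period p c") (simp_all add: full_cycle_def)
qed simp

lemma distinct_orbits_walk: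
  assumes p: "permutation p" and "distinct (walk p C)"
  shows "distinct (map (orbit p) C)"
  using assms(2)
proof (induction C rule: rev_induct)
  case (snoc c C)
  then have "set (walk p C) \<inter> orbit p c = {}" by (simp add: set_full_cycle[OF p])
  then have "orbit p c \<notin> orbit p ` set C" using permutation_self_in_orbit[OF p, of c]
    by (auto simp: set_walk[OF p])
  then show ?case using snoc by simp
qed simp

section \<open>The expected number of cycles\<close>

lemma card_image_le_of_factor:
  assumes "finite S" "\<And>x y. x \<in> S \<Longrightarrow> y \<in> S \<Longrightarrow> f x = f y \<Longrightarrow> g x = g y"
  shows "card (g ` S) \<le> card (f ` S)"
proof -
  have "g x = g (inv_into S f (f x))" if "x \<in> S" for x
    using that by (intro assms(2)) (simp_all add: inv_into_into f_inv_into_f)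
  then have "g ` S = (g \<circ> inv_into S f) ` (f ` S)"
    by (auto simp: image_image)
  then show ?thesis using assms(1) card_image_le[of "f ` S" "g \<circ> inv_into S f"] by simp
qed

text \<open>
  Composing with the transposition of \<open>a\<close> and \<open>b\<close> splices the fixed point \<open>a\<close> into the cycle of \<open>b\<close>,
  immediately before \<open>b\<close>.  The points other than \<open>a\<close> are therefore partitioned into cycles as before.
\<close>

lemma orbit_transpose_comp_iff:
  assumes p: "p permutes S" and a: "a \<notin> S" and b: "b \<in> S" and xy: "x \<in> S" "y \<in> S"
  shows "y \<in> orbit (Transposition.transpose a b \<circ> p) x \<longleftrightarrow> y \<in> orbit p x"
proof
  let ?p' = "Transposition.transpose a b \<circ> p"
  have pS: "p z \<in> S" if "z \<in> S" for z using p that by (simp add: permutes_in_image)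
  have pa: "p a = a" using p a by (rule permutes_not_in)
  have p'a: "?p' a = b" using pa by simp
  have p'S: "?p' z = (if p z = b then a else p z)" if "z \<in> S" for z
    using pS[OF that] a by (auto simp: Transposition.transpose_def)
  show "y \<in> orbit p x" if "y \<in> orbit ?p' x"
  proof -
    from that have "y = a \<and> b \<in> orbit p x \<or> y \<in> orbit p x \<and> y \<in> S"
    proof induction
      case base
      then show ?case using p'S[OF xy(1)] pS[OF xy(1)] orbit.base[of p x] by auto
    next
      case (step z)
      from step.IH show ?case
      proof
        assume "z = a \<and> b \<in> orbit p x" 
        then show ?thesis using p'a b by auto
      next
        assume z: "z \<in> orbit p x \<and> z \<in> S"
        then show ?thesis using p'S[of z] pS[of z] orbit.step[of z p x] by auto
      qed
    qed
    then show ?thesis using xy a by auto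
  qed
  show "y \<in> orbit ?p' x" if "y \<in> orbit p x"
  proof -
    have up: "p z \<in> orbit ?p' x" if "?p' z \<in> orbit ?p' x" "z \<in> S" for z
    proof (cases "p z = b")
      case True
      then have "a \<in> orbit ?p' x" using that p'S by auto
      then show ?thesis using orbit.step[of a ?p' x] True p'a by simp
    qed (use that p'S in auto)
    from that have "y \<in> orbit ?p' x \<and> y \<in> S"
    proof induction
      case base
      then show ?case using up[of x] orbit.base[of ?p' x] xy pS by blast
    next
      case (step z)
      then show ?case using up[of z] orbit.step[of z ?p' x] pS by blast
    qed
    then show ?thesis ..
  qed
qed

lemma card_cycles_transpose_comp:
  assumes fin: "finite S" and p: "p permutes S" and a: "a \<notin> S" and b: "b \<in> S"
  shows "card (cycles (insert a S) (Transposition.transpose a b \<circ> p)) = card (cycles S p)"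
proof -
  let ?p' = "Transposition.transpose a b \<circ> p"
  have p': "?p' permutes insert a S"
    using p b by (intro permutes_compose permutes_subset[OF p] permutes_swap_id) auto
  have perm: "permutation p" "permutation ?p'"
    using fin p p' unfolding permutation_permutes by blast+
  have iff: "orbit ?p' x = orbit ?p' y \<longleftrightarrow> orbit p x = orbit p y" if "x \<in> S" "y \<in> S" for x y
    using orbit_transpose_comp_iff[OF p a b that] orbit_eq_of_mem perm
      permutation_self_in_orbit by metis
  have "?p' a = b" using permutes_not_in[OF p a] by simp
  then have "orbit ?p' a = orbit ?p' b"
    using permutation_orbit_step[OF perm(2), of a] by simp
  then have "cycles (insert a S) ?p' = orbit ?p' ` S" using b by (auto simp: cycles_def)
  moreover have "card (orbit ?p' ` S) = card (orbit p ` S)"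
    by (rule antisym; rule card_image_le_of_factor[OF fin]; simp only: iff)
  ultimately show ?thesis by (simp add: cycles_def)
qed

lemma card_cycles_insert_fixed:
  assumes fin: "finite S" and p: "p permutes S" and a: "a \<notin> S"
  shows "card (cycles (insert a S) p) = Suc (card (cycles S p))"
proof -
  have "orbit p a = {a}" using permutes_not_in[OF p a] by (simp add: orbit_eq_singleton_iff)
  moreover have "{a} \<notin> orbit p ` S" using permutes_orbit_subset[OF p] a by blast
  ultimately show ?thesis using fin by (simp add: cycles_def)
qed

text \<open>
  Every permutation of \<open>insert a S\<close> arises exactly once from a permutation of \<open>S\<close> by choosing where to
  splice in \<open>a\<close>.  Only one of the \<open>card S + 1\<close> choices, that of a new fixed point, adds a cycle.  So the
  total number \<open>T\<close> of cycles satisfies \<open>T (m + 1) = (m + 1) * T m + fact m\<close>, and \<open>T m / fact m\<close> grows by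
  \<open>1 / (m + 1)\<close> in each step.
\<close>

lemma sum_card_cycles:
  assumes "finite S"
  shows "(\<Sum>p | p permutes S. real (card (cycles S p))) = fact (card S) * harm (card S)"
  using assms
proof (induction S rule: finite_induct)
  case empty
  then show ?case by (simp add: cycles_def harm_expand)
next
  case (insert a S)
  let ?P = "{p. p permutes S}" and ?T = "\<lambda>S. \<Sum>p | p permutes S. real (card (cycles S p))"
  have "?T (insert a S) = 
      (\<Sum>b\<in>insert a S. \<Sum>p\<in>?P. real (card (cycles (insert a S) (Transposition.transpose a b \<circ> p))))"
    using insert.hyps by (rule sum_over_permutations_insert)
  also have "\<dots> = (\<Sum>p\<in>?P. real (card (cycles (insert a S) p))) +
      (\<Sum>b\<in>S. \<Sum>p\<in>?P. real (card (cycles (insert a S) (Transposition.transpose a b \<circ> p))))"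
    using insert.hyps by simp
  also have "(\<Sum>p\<in>?P. real (card (cycles (insert a S) p))) = ?T S + fact (card S)"
    using insert.hyps
    by (simp add: card_cycles_insert_fixed sum.distrib card_permutations[OF refl])
  also have "(\<Sum>b\<in>S. \<Sum>p\<in>?P. real (card (cycles (insert a S) (Transposition.transpose a b \<circ> p)))) =
      real (card S) * ?T S"
    using insert.hyps by (simp add: card_cycles_transpose_comp)
  also have "?T S + fact (card S) + real (card S) * ?T S =
      fact (Suc (card S)) * harm (Suc (card S))"
    unfolding insert.IH by (simp add: harm_Suc field_simps)
  finally show ?case using insert.hyps by simp
qed

lemma expectation_uniform_perm:
  fixes f :: "('a \<Rightarrow> 'a) \<Rightarrow> real"
  assumes "finite \<Omega>"
  shows "measure_pmf.expectation (uniform_perm \<Omega>) f = (\<Sum>p | p permutes \<Omega>. f p) / fact (card \<Omega>)"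
  unfolding uniform_perm_def
  using assms by (subst integral_pmf_of_set)
    (auto simp: card_permutations[OF refl] finite_permutations intro: permutes_id)

lemma expectation_card_cycles:
  assumes "finite \<Omega>"
  shows "measure_pmf.expectation (uniform_perm \<Omega>) (\<lambda>p. u + v * real (card (cycles \<Omega> p))) =
    u + v * harm (card \<Omega>)"
  using assms
  by (simp add: expectation_uniform_perm sum.distrib card_permutations[OF refl]
      sum_card_cycles field_simps flip: sum_distrib_left)

lemma sum_card_cycles_eq_card:
  assumes fin: "finite \<Omega>" and p: "p permutes \<Omega>"
  shows "(\<Sum>c\<in>cycles \<Omega> p. card c) = card \<Omega>"
proof -
  have perm: "permutation p" using assms by (auto simp: permutation_permutes)
  have "(\<Union>c\<in>cycles \<Omega> p. c) = \<Omega>"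
    using permutes_orbit_subset[OF p] permutation_self_in_orbit[OF perm] 
    by (auto simp: cycles_def)
  moreover have "card (\<Union>c\<in>cycles \<Omega> p. c) = (\<Sum>c\<in>cycles \<Omega> p. card c)"
  proof (rule card_UN_disjoint)
    show "\<forall>c\<in>cycles \<Omega> p. \<forall>c'\<in>cycles \<Omega> p. c \<noteq> c' \<longrightarrow> c \<inter> c' = {}"
      using orbit_eq_of_mem[OF perm] unfolding cycles_def by blast
  qed (use fin finite_orbit_permutation[OF perm] in \<open>auto simp: cycles_def\<close>)
  ultimately show ?thesis by simp
qed

text \<open>
  Rounding up costs less than one per cycle, and the unrounded quotients add up to
  \<open>card \<Omega> / \<alpha>\<close>.  Strictness needs at least one cycle.
\<close>

lemma sum_ceiling_cycles_less:
  assumes fin: "finite \<Omega>" and p: "p permutes \<Omega>" and "\<Omega> \<noteq> {}"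
  shows "(\<Sum>c\<in>cycles \<Omega> p. real_of_int \<lceil>real (card c) / real \<alpha>\<rceil>) <
    real (card \<Omega>) / real \<alpha> + real (card (cycles \<Omega> p))"
proof -
  have "(\<Sum>c\<in>cycles \<Omega> p. real_of_int \<lceil>real (card c) / real \<alpha>\<rceil>) <
      (\<Sum>c\<in>cycles \<Omega> p. real (card c) / real \<alpha> + 1)"
    using assms by (intro sum_strict_mono) (auto simp: cycles_def, linarith)
  also have "\<dots> = real (card \<Omega>) / real \<alpha> + real (card (cycles \<Omega> p))"
    using sum_card_cycles_eq_card[OF fin p]
    by (simp add: sum.distrib flip: sum_divide_distrib of_nat_sum)
  finally show ?thesis .
qed

text \<open>
  The pointwise bound is affine in the number of cycles, so its expectation is exact; strictness
  survives the average because there are finitely many permutations.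
\<close>

lemma expectation_type5_less:
  assumes fin: "finite \<Omega>" and "\<Omega> \<noteq> {}" and "0 < (u::real)"
  shows "measure_pmf.expectation (uniform_perm \<Omega>)
      (\<lambda>p. (\<Sum>c\<in>cycles \<Omega> p. real_of_int \<lceil>real (card c) / real \<alpha>\<rceil>) * u
        + (2 * real (card (cycles \<Omega> p)) - 1) * v)
    < (real (card \<Omega>) / real \<alpha> + harm (card \<Omega>)) * u + (2 * harm (card \<Omega>) - 1) * v"
proof -
  let ?r = "\<lambda>p. real (card (cycles \<Omega> p))"
  have "measure_pmf.expectation (uniform_perm \<Omega>)
      (\<lambda>p. (\<Sum>c\<in>cycles \<Omega> p. real_of_int \<lceil>real (card c) / real \<alpha>\<rceil>) * u + (2 * ?r p - 1) * v)
    < measure_pmf.expectation (uniform_perm \<Omega>)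
      (\<lambda>p. (real (card \<Omega>) / real \<alpha> * u - v) + (u + 2 * v) * ?r p)"
    unfolding expectation_uniform_perm[OF fin]
  proof (intro divide_strict_right_mono sum_strict_mono)
    fix p assume "p \<in> {p. p permutes \<Omega>}"
    then have "(\<Sum>c\<in>cycles \<Omega> p. real_of_int \<lceil>real (card c) / real \<alpha>\<rceil>) * u <
        (real (card \<Omega>) / real \<alpha> + ?r p) * u"
      using sum_ceiling_cycles_less assms by (intro mult_strict_right_mono) auto
    then show "(\<Sum>c\<in>cycles \<Omega> p. real_of_int \<lceil>real (card c) / real \<alpha>\<rceil>) * u + (2 * ?r p - 1) * v
      < (real (card \<Omega>) / real \<alpha> * u - v) + (u + 2 * v) * ?r p"
      by (simp add: algebra_simps)
  qed (use fin in \<open>auto simp: finite_permutations intro: permutes_id\<close>)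
  also have "\<dots> = (real (card \<Omega>) / real \<alpha> + harm (card \<Omega>)) * u + (2 * harm (card \<Omega>) - 1) * v"
    unfolding expectation_card_cycles[OF fin] by (simp add: algebra_simps)
  finally show ?thesis .
qed

section \<open>The structure found by MonodromySolve\<close>

text \<open>
  The permutations \<open>p\<close> and \<open>q\<close> play the roles of \<open>\<sigma>\<^sub>0\<close> and \<open>\<sigma>\<^sub>1\<close>.  Transitivity enters only through the
  last assumption: a set of points that contains the seed and is
  closed under both permutations is everything.
\<close>

locale monodromy_pair =
  fixes \<Omega> :: "'a set" and p q :: "'a \<Rightarrow> 'a" and s :: 'a
  assumes finite_pts: "finite \<Omega>" and p_permutes: "p permutes \<Omega>" and q_permutes: "q permutes \<Omega>"
    and seed: "s \<in> \<Omega>"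
    and closed_eq: "\<And>S. S \<subseteq> \<Omega> \<Longrightarrow> s \<in> S \<Longrightarrow> p ` S \<subseteq> S \<Longrightarrow> q ` S \<subseteq> S \<Longrightarrow> S = \<Omega>"
begin

lemma p_permutation: "permutation p"
  using finite_pts p_permutes by (auto simp: permutation_permutes)

lemma orbit_subset_pts: "c \<in> \<Omega> \<Longrightarrow> orbit p c \<subseteq> \<Omega>"
  using p_permutes by (rule permutes_orbit_subset)

text \<open>
  \<open>grows C F\<close> says that \<open>C\<close> and \<open>F\<close> are the cycle starts and the founder indices of an initial part
  of the monodromy tree: each start after the seed is the image under \<open>\<sigma>\<^sub>1\<close> of a point that already
  occurs in the walk along the earlier cycles, at the (1-based) position given by its founder index.
  The solver produces such a pair, and every unpacking procedure is analysed by induction on it.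
\<close>

inductive grows :: "'a list \<Rightarrow> nat list \<Rightarrow> bool" where
  seed_cycle: "grows [s] []"
| founded_cycle: "grows C F \<Longrightarrow> 1 \<le> f \<Longrightarrow> f \<le> length (walk p C) \<Longrightarrow>
    q (walk p C ! (f - 1)) \<notin> set (walk p C) \<Longrightarrow>
    grows (C @ [q (walk p C ! (f - 1))]) (F @ [f])"

lemma grows_length: "grows C F \<Longrightarrow> length C = Suc (length F)"
  by (induction rule: grows.induct) auto

lemma grows_nonempty: "grows C F \<Longrightarrow> C \<noteq> []"
  by (induction rule: grows.induct) auto

lemma grows_subset: "grows C F \<Longrightarrow> set C \<subseteq> \<Omega>"
proof (induction rule: grows.induct)
  case (founded_cycle C F f)
  have "walk p C ! (f - 1) \<in> set (walk p C)" using founded_cycle by (intro nth_mem) auto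
  then have "walk p C ! (f - 1) \<in> \<Omega>"
    using founded_cycle orbit_subset_pts by (auto simp: set_walk[OF p_permutation])
  then show ?case using founded_cycle permutes_in_image[OF q_permutes] by auto
qed (simp add: seed)

lemma grows_walk_subset: "grows C F \<Longrightarrow> set (walk p C) \<subseteq> \<Omega>"
  using grows_subset orbit_subset_pts by (fastforce simp: set_walk[OF p_permutation])

lemma seed_in_walk: "grows C F \<Longrightarrow> s \<in> set (walk p C)"
  by (induction rule: grows.induct)
    (auto simp: walk_single set_full_cycle p_permutation permutation_self_in_orbit)

lemma grows_distinct: "grows C F \<Longrightarrow> distinct (walk p C)"
proof (induction rule: grows.induct)
  case (founded_cycle C F f)
  then show ?case using orbit_disjoint_walk[OF p_permutation, of _ C]
    by (auto simp: set_full_cycle[OF p_permutation] distinct_full_cycle[OF p_permutation])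
qed (simp add: walk_single distinct_full_cycle[OF p_permutation])

lemma orbits_eq_cycles:
  assumes "grows C F" "set (walk p C) = \<Omega>"
  shows "set (map (orbit p) C) = cycles \<Omega> p"
proof -
  have "orbit p ` set (walk p C) = orbit p ` set C"
    using permutation_self_in_orbit[OF p_permutation]
    by (auto simp: set_walk[OF p_permutation] image_iff dest: orbit_eq_of_mem[OF p_permutation])
  then show ?thesis using assms by (simp add: cycles_def)
qed

lemma image_last_walk: "grows C F \<Longrightarrow> p (last (walk p C)) \<in> set (walk p C)"
proof -
  assume g: "grows C F"
  have "walk p C \<noteq> []" using seed_in_walk[OF g] by auto
  then have "last (walk p C) \<in> set (walk p C)" by simp
  from orbit_subset_walk[OF p_permutation this] show ?thesis
    by (meson orbit.base subsetD)
qed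

text \<open>
  The query \<open>\<sigma>\<^sub>0 (last S)\<close> cannot return a known point before the current cycle is complete.  So in
  types I and II a known answer signals the end of the cycle, and no cycle lengths are needed.
\<close>

lemma new_in_cycle:
  assumes "distinct (xs @ full_cycle p c)" "Suc k < period p c"
  shows "(p ^^ Suc k) c \<notin> set (xs @ traverse p c (Suc k))"
proof -
  have "full_cycle p c = traverse p c (Suc k) @ (p ^^ Suc k) c # drop (Suc (Suc k)) (full_cycle p c)"
    using traverse_append_full[of "Suc (Suc k)" p c] assms(2) by (simp add: traverse_Suc)
  then have "distinct (xs @ traverse p c (Suc k) @ (p ^^ Suc k) c # drop (Suc (Suc k)) (full_cycle p c))"
    using assms(1) by simp
  then show ?thesis by auto
qed

text \<open>
  All points before the search position have been tried with \<open>\<sigma>\<^sub>1\<close> and led to known points.  Outside a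
  search the position is one more than the last founder.  \<open>\<sigma>\<^sub>0\<close> has been
  queried once at every known point but the last, and during a search once at the last point too; \<open>\<sigma>\<^sub>1\<close> has
  been queried once at every point before the search position.  This gives the query count.
\<close>

definition solve_inv :: "'a solve_state \<Rightarrow> bool" where
  "solve_inv st \<longleftrightarrow> (\<exists>C c k. grows (C @ [c]) (founders st) \<and>
     sols st = walk p C @ traverse p c k \<and> 0 < k \<and> k \<le> period p c \<and>
     (searching st \<longrightarrow> k = period p c) \<and>
     0 < pos st \<and>
     (\<forall>j. 0 < j \<and> j < pos st \<longrightarrow> j \<le> length (sols st) \<and> q (sols st ! (j - 1)) \<in> set (sols st)) \<and>
     Suc (queries st) = length (sols st) + (pos st - 1) + (if searching st then 1 else 0) \<and>
     (\<forall>f\<in>set (founders st). f < pos st) \<and>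
     (\<not> searching st \<longrightarrow>
        pos st = Suc (if founders st = [] then 0 else Max (set (founders st)))))"

text \<open>
  The search never runs off the end of the list: otherwise the known points would be closed under both
  permutations, hence would be all of them.
\<close>

lemma pos_le:
  assumes g: "grows C F" and "length (walk p C) < card \<Omega>"
    and old: "\<forall>j. 0 < j \<and> j < i \<longrightarrow> j \<le> length (walk p C) \<and> q (walk p C ! (j - 1)) \<in> set (walk p C)"
  shows "i \<le> length (walk p C)"
proof (rule ccontr)
  assume i: "\<not> ?thesis"
  have "q ` set (walk p C) \<subseteq> set (walk p C)"
  proof
    fix y assume "y \<in> q ` set (walk p C)"
    then obtain m where m: "m < length (walk p C)" "y = q (walk p C ! m)"
      by (auto simp: in_set_conv_nth)
    then show "y \<in> set (walk p C)" using old[rule_format, of "Suc m"] i by auto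
  qed
  moreover have "p ` set (walk p C) \<subseteq> set (walk p C)"
    using orbit_subset_walk[OF p_permutation] orbit.base[of p] by blast
  ultimately have "set (walk p C) = \<Omega>"
    using grows_walk_subset[OF g] seed_in_walk[OF g] closed_eq by metis
  then show False using distinct_card[OF grows_distinct[OF g]] assms(2) by simp
qed

lemma solve_inv_step:
  assumes inv: "solve_inv st" and lt: "length (sols st) < card \<Omega>"
  shows "solve_inv (solve_step (p, q) st) \<and> (searching st \<longrightarrow> pos st < card \<Omega>)"
proof -
  from inv obtain C c k where g: "grows (C @ [c]) (founders st)"
    and S: "sols st = walk p C @ traverse p c k" and k: "0 < k" "k \<le> period p c"
    and srch: "searching st \<Longrightarrow> k = period p c"
    and pos: "0 < pos st"
    and old: "\<forall>j. 0 < j \<and> j < pos st \<longrightarrow> j \<le> length (sols st) \<and> q (sols st ! (j - 1)) \<in> set (sols st)"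
    and qs: "Suc (queries st) = length (sols st) + (pos st - 1) + (if searching st then 1 else 0)"
    and F: "\<forall>f\<in>set (founders st). f < pos st"
    and mx: "\<not> searching st \<longrightarrow>
        pos st = Suc (if founders st = [] then 0 else Max (set (founders st)))"
    unfolding solve_inv_def by blast
  have full: "sols st = walk p (C @ [c])" if "k = period p c"
    using that S by (simp add: full_cycle_def)
  have dist: "distinct (walk p C @ full_cycle p c)" using grows_distinct[OF g] by simp
  have last: "p (last (sols st)) = (p ^^ k) c" unfolding S using k by (rule_tac last_append_traverse)
  consider "\<not> searching st" "k < period p c" | "\<not> searching st" "k = period p c" | "searching st"
    using k by linarith
  then show ?thesis
  proof cases
    case 1
    have new: "(p ^^ k) c \<notin> set (sols st)"
      using new_in_cycle[OF dist, of "k - 1"] 1 k by (simp add: S)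
    have st': "solve_step (p, q) st = st\<lparr>queries := queries st + 1, sols := sols st @ [(p ^^ k) c]\<rparr>"
      using 1 new last by (simp add: solve_step_def Let_def)
    have "q ((sols st @ [(p ^^ k) c]) ! (j - 1)) \<in> set (sols st @ [(p ^^ k) c]) \<and> j \<le> length (sols st)"
      if "0 < j" "j < pos st" for j
      using old that by (auto simp: nth_append)
    then have "solve_inv (solve_step (p, q) st)"
      unfolding st' solve_inv_def using g S k 1 qs F mx pos
      by (intro exI[of _ C] exI[of _ c] exI[of _ "Suc k"]) (auto simp: traverse_Suc le_Suc_eq)
    then show ?thesis using 1 by simp
  next
    case 2
    have "(p ^^ k) c \<in> set (sols st)"
      using 2 image_last_walk[OF g] last full by simp
    then have st': "solve_step (p, q) st = st\<lparr>queries := queries st + 1, searching := True\<rparr>"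
      using 2 last by (simp add: solve_step_def Let_def)
    have "solve_inv (solve_step (p, q) st)"
      unfolding st' solve_inv_def using g S k 2 qs F mx pos old
      by (intro exI[of _ C] exI[of _ c] exI[of _ k]) auto
    then show ?thesis using 2 by simp
  next
    case 3
    then have S': "sols st = walk p (C @ [c])" using srch full by simp
    let ?j = "pos st" and ?y = "q (sols st ! (pos st - 1))"
    have le: "?j \<le> length (sols st)"
      using pos_le[OF g, of ?j] old lt unfolding S' by blast
    show ?thesis
    proof (cases "?y \<in> set (sols st)")
      case True
      then have st': "solve_step (p, q) st = st\<lparr>queries := queries st + 1, pos := pos st + 1\<rparr>"
        using 3 by (simp add: solve_step_def Let_def)
      have old': "j \<le> length (sols st) \<and> q (sols st ! (j - 1)) \<in> set (sols st)"
        if "0 < j" "j < Suc ?j" for j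
        using old that True le by (cases "j = ?j") auto
      have "solve_inv (solve_step (p, q) st)"
        unfolding st' solve_inv_def using g S k 3 qs F pos old' srch
        by (intro exI[of _ C] exI[of _ c] exI[of _ k]) (auto simp: less_Suc_eq)
      then show ?thesis using le lt by simp
    next
      case False
      then have st': "solve_step (p, q) st = st\<lparr>queries := queries st + 1, sols := sols st @ [?y],
          founders := founders st @ [?j], pos := pos st + 1, searching := False\<rparr>"
        using 3 by (simp add: solve_step_def Let_def)
      have old': "j \<le> length (sols st) \<and> q ((sols st @ [?y]) ! (j - 1)) \<in> set (sols st @ [?y])"
        if "0 < j" "j < Suc ?j" for j
        using old that le pos by (cases "j = ?j") (auto simp: nth_append)
      have g': "grows ((C @ [c]) @ [?y]) (founders st @ [?j])"
        unfolding S' by (rule founded_cycle[OF g]) (use pos le False S' in auto)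
      have "Max (set (founders st @ [?j])) = ?j"
        by (rule Max_eqI) (use F in \<open>auto intro: less_imp_le\<close>)
      then have "solve_inv (solve_step (p, q) st)"
        unfolding st' solve_inv_def using g' S' k 3 qs F pos old' period_pos[OF p_permutation, of ?y]
        by (intro exI[of _ "C @ [c]"] exI[of _ ?y] exI[of _ 1])
          (auto simp: less_Suc_eq le_Suc_eq Suc_le_eq traverse_1)
      then show ?thesis using le lt by simp
    qed
  qed
qed

lemma solve_inv_init:
  "solve_inv \<lparr>sols = [s], pos = 1, searching = False, founders = [], queries = 0\<rparr>"
  unfolding solve_inv_def using seed_cycle period_pos[OF p_permutation, of s]
  by (intro exI[of _ "[]"] exI[of _ s] exI[of _ 1]) (auto simp: traverse_1 Suc_le_eq)

lemma monodromy_solve_terminates: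
  obtains st C where "monodromy_solve (card \<Omega>) (p, q) s = Some st" "grows C (founders st)"
    "sols st = walk p C" "set (sols st) = \<Omega>"
    "Suc (queries st) = card \<Omega> + (if founders st = [] then 0 else Max (set (founders st)))"
    "\<forall>f\<in>set (founders st). f \<le> card \<Omega>"
proof -
  let ?b = "\<lambda>st. length (sols st) < card \<Omega>"
  let ?init = "\<lparr>sols = [s], pos = 1, searching = False, founders = [], queries = 0\<rparr>"
  define inv' where "inv' st \<longleftrightarrow> solve_inv st \<and> length (sols st) \<le> card \<Omega> \<and>
     (length (sols st) = card \<Omega> \<longrightarrow> \<not> searching st)" for st :: "'a solve_state"
  \<comment> \<open>A step that ends a search finds a point and advances the position, which outweighs the flag.\<close>
  define \<mu> where "\<mu> st = (card \<Omega> - length (sols st)) + (card \<Omega> + 1 - pos st) +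
     (if searching st then 0 else 1)" for st :: "'a solve_state"
  have card_pos: "card \<Omega> > 0" using finite_pts seed by (auto simp: card_gt_0_iff)
  have step: "inv' (solve_step (p, q) st)" if "inv' st" "?b st" for st
    using that solve_inv_step[of st] unfolding inv'_def
    by (auto simp: solve_step_def Let_def)
  have "\<mu> (solve_step (p, q) st) < \<mu> st" if "inv' st" "?b st" for st
    using that solve_inv_step[of st] unfolding inv'_def \<mu>_def
    by (auto simp: solve_step_def Let_def)
  then have "\<exists>t. while_option ?b (solve_step (p, q)) ?init = Some t"
    using step solve_inv_init card_pos
    by (intro measure_while_option_Some[where P = inv' and f = \<mu>]) (auto simp: inv'_def)
  then obtain st where st: "while_option ?b (solve_step (p, q)) ?init = Some st" by blast
  have "inv' st"
    using while_option_rule[where P = inv', OF _ st] step solve_inv_init card_pos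
    by (auto simp: inv'_def)
  moreover have "\<not> ?b st" using while_option_stop[OF st] .
  ultimately have inv: "solve_inv st" and len: "length (sols st) = card \<Omega>" and ns: "\<not> searching st"
    by (auto simp: inv'_def)
  from inv obtain C c k where g: "grows (C @ [c]) (founders st)"
    and S: "sols st = walk p C @ traverse p c k" and k: "0 < k" "k \<le> period p c"
    and pos: "0 < pos st"
    and old: "\<forall>j. 0 < j \<and> j < pos st \<longrightarrow> j \<le> length (sols st) \<and> q (sols st ! (j - 1)) \<in> set (sols st)"
    and qs: "Suc (queries st) = length (sols st) + (pos st - 1) + (if searching st then 1 else 0)"
    and F: "\<forall>f\<in>set (founders st). f < pos st"
    and mx: "\<not> searching st \<longrightarrow>
        pos st = Suc (if founders st = [] then 0 else Max (set (founders st)))"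
    unfolding solve_inv_def by blast
  have "card (set (walk p (C @ [c]))) \<le> card \<Omega>"
    by (rule card_mono[OF finite_pts grows_walk_subset[OF g]])
  then have "length (walk p (C @ [c])) \<le> card \<Omega>"
    using distinct_card[OF grows_distinct[OF g]] by simp
  then have "k = period p c" using S k len by simp
  then have SW: "sols st = walk p (C @ [c])" using S by (simp add: full_cycle_def)
  have "set (sols st) = \<Omega>"
    unfolding SW using finite_pts grows_walk_subset[OF g] distinct_card[OF grows_distinct[OF g]] len SW
    by (intro card_subset_eq) auto
  moreover have "f \<le> card \<Omega>" if "f \<in> set (founders st)" for f
    using that F old len by (cases "f = 0") auto
  ultimately show ?thesis
    using that[OF _ g SW] st qs len ns mx unfolding monodromy_solve_def by simp
qed

end

section \<open>Unpacking\<close>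

text \<open>
  Each unpacking loop appends exactly one point per iteration, so its guard can be ignored: any
  state with \<open>d\<close> points that is reached by iterating the body is the state in which the loop stops.
\<close>

definition reaches :: "('b \<Rightarrow> 'b) \<Rightarrow> 'b \<Rightarrow> 'b \<Rightarrow> bool" where
  "reaches f x y \<longleftrightarrow> (\<exists>n. (f ^^ n) x = y)"

lemma reaches_refl: "reaches f x x"
  unfolding reaches_def by (rule exI[of _ 0]) simp

lemma reaches_step: "reaches f x y \<Longrightarrow> f y = z \<Longrightarrow> reaches f x z"
  unfolding reaches_def by (metis comp_apply funpow.simps(2))

lemma while_option_reaches:
  assumes "reaches f x y" and grow: "\<And>z. length (fst (f z)) = Suc (length (fst z))"
    and "length (fst y) = d"
  shows "while_option (\<lambda>(S, _). length S < d) f x = Some y"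
proof -
  from assms(1) obtain n where "(f ^^ n) x = y" by (auto simp: reaches_def)
  then show ?thesis
  proof (induction n arbitrary: x)
    case 0
    then show ?case using assms(3) by (subst while_option_unfold) (auto split: prod.splits)
  next
    case (Suc n)
    have len: "length (fst ((f ^^ m) z)) = length (fst z) + m" for m z
      by (induction m) (simp_all add: grow)
    from Suc.prems have y: "(f ^^ n) (f x) = y" by (simp add: funpow_swap1)
    from len[of "Suc n" x] Suc.prems assms(3) have "length (fst x) < d" by simp
    then show ?case using Suc.IH[OF y] by (subst while_option_unfold) (auto split: prod.splits)
  qed
qed

definition stored_points :: "nat \<Rightarrow> ('a \<Rightarrow> 'a) \<Rightarrow> 'a \<Rightarrow> 'a list" where
  "stored_points \<alpha> p c = map (\<lambda>k. (p ^^ k) c) (filter (\<lambda>k. \<alpha> dvd k) [0..<period p c])"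

context monodromy_pair begin

lemma unpack2_cycle:
  assumes "distinct (xs @ full_cycle p c)" "k < period p c"
    and "reaches (unpack_step2 (p, q)) x (xs @ [c], F, K)"
  shows "reaches (unpack_step2 (p, q)) x (xs @ traverse p c (Suc k), F, K + k)"
  using assms(2)
proof (induction k)
  case 0
  then show ?case using assms(3) by (simp add: traverse_1)
next
  case (Suc k)
  then show ?case
    using new_in_cycle[OF assms(1), of k] last_append_traverse[of "Suc k" p xs c]
    by (intro reaches_step[OF Suc.IH]) (simp_all add: unpack_step2_def traverse_Suc)
qed

text \<open>
  Inside a cycle each query yields a new point, so the founder list is left alone until the cycle is
  complete.
\<close>

lemma unpack2_full_cycle:
  assumes "distinct (xs @ full_cycle p c)"
    and "reaches (unpack_step2 (p, q)) x (xs @ [c], F, K)"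
  shows "\<exists>L. Suc L = K + period p c \<and>
    reaches (unpack_step2 (p, q)) x (xs @ full_cycle p c, F, L)"
  using unpack2_cycle[OF assms(1) _ assms(2), of "period p c - 1"] period_pos[OF p_permutation, of c]
  by (intro exI[of _ "K + (period p c - 1)"]) (simp add: full_cycle_def)

text \<open>
  The known answer at the end of each cycle but the last is the one wasted query per founder.  The
  lists \<open>F'\<close> here and \<open>M'\<close>, \<open>C'\<close> below stand for the data of cycles not yet reached; the induction needs
  them arbitrary.
\<close>

lemma unpack2_reaches:
  "grows C F \<Longrightarrow> \<exists>L. Suc L = length (walk p C) + length F \<and>
     reaches (unpack_step2 (p, q)) ([s], F @ F', 0) (walk p C, F', L)"
proof (induction arbitrary: F' rule: grows.induct)
  case seed_cycle
  show ?case
    using unpack2_full_cycle[of "[]" s _ F' 0, OF _ reaches_refl] distinct_full_cycle[OF p_permutation]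
    by (simp add: walk_single)
next
  case (founded_cycle C F f)
  let ?c = "q (walk p C ! (f - 1))"
  let ?init = "([s], F @ f # F', 0)"
  obtain K where K: "Suc K = length (walk p C) + length F"
    and r: "reaches (unpack_step2 (p, q)) ?init (walk p C, f # F', K)"
    using founded_cycle.IH by blast
  have "reaches (unpack_step2 (p, q)) ?init (walk p C @ [?c], F', K + 2)"
    by (rule reaches_step[OF r])
      (simp add: unpack_step2_def image_last_walk[OF founded_cycle.hyps(1)])
  moreover have "distinct (walk p C @ full_cycle p ?c)"
    using grows_distinct[OF grows.founded_cycle[OF founded_cycle.hyps]] by simp
  ultimately obtain L where "Suc L = (K + 2) + period p ?c"
    "reaches (unpack_step2 (p, q)) ?init (walk p C @ full_cycle p ?c, F', L)"
    using unpack2_full_cycle by blast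
  then show ?case using K by (intro exI[of _ L]) simp
qed

lemma unpack3_cycle:
  assumes "k < period p c"
    and "reaches (unpack_step3 (p, q)) x (xs @ [c], 1, period p c # M, F, K)"
  shows "reaches (unpack_step3 (p, q)) x (xs @ traverse p c (Suc k), Suc k, period p c # M, F, K + k)"
  using assms(1)
proof (induction k)
  case 0
  then show ?case using assms(2) by (simp add: traverse_1)
next
  case (Suc k)
  then show ?case
    using last_append_traverse[of "Suc k" p xs c]
    by (intro reaches_step[OF Suc.IH]) (simp_all add: unpack_step3_def traverse_Suc)
qed

lemma unpack3_full_cycle:
  assumes "reaches (unpack_step3 (p, q)) x (xs @ [c], 1, period p c # M, F, K)"
  shows "\<exists>L. Suc L = K + period p c \<and>
    reaches (unpack_step3 (p, q)) x (xs @ full_cycle p c, period p c, period p c # M, F, L)"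
  using unpack3_cycle[OF _ assms, of "period p c - 1"] period_pos[OF p_permutation, of c]
  by (intro exI[of _ "K + (period p c - 1)"]) (simp add: full_cycle_def)

lemma unpack3_reaches:
  "grows C F \<Longrightarrow> \<exists>L. Suc L = length (walk p C) \<and>
     reaches (unpack_step3 (p, q)) ([s], 1, map (period p) C @ M', F @ F', 0)
       (walk p C, period p (last C), period p (last C) # M', F', L)"
proof (induction arbitrary: F' M' rule: grows.induct)
  case seed_cycle
  show ?case
    using unpack3_full_cycle[of _ "[]" s M' F' 0, OF reaches_refl] by (simp add: walk_single)
next
  case (founded_cycle C F f)
  let ?c = "q (walk p C ! (f - 1))"
  let ?init = "([s], 1, map (period p) C @ period p ?c # M', F @ f # F', 0)"
  obtain K where K: "Suc K = length (walk p C)"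
    and r: "reaches (unpack_step3 (p, q)) ?init
      (walk p C, period p (last C), period p (last C) # period p ?c # M', f # F', K)"
    using founded_cycle.IH by blast
  have "reaches (unpack_step3 (p, q)) ?init (walk p C @ [?c], 1, period p ?c # M', F', K + 1)"
    by (rule reaches_step[OF r]) (simp add: unpack_step3_def)
  from unpack3_full_cycle[OF this] obtain L where "Suc L = (K + 1) + period p ?c"
    "reaches (unpack_step3 (p, q)) ?init
      (walk p C @ full_cycle p ?c, period p ?c, period p ?c # M', F', L)" by blast
  then show ?case using K by (intro exI[of _ L]) simp
qed

lemma stored_points_Cons:
  "stored_points \<alpha> p c = c # map (\<lambda>k. (p ^^ k) c) (filter (\<lambda>k. \<alpha> dvd k) [1..<period p c])"
  using period_pos[OF p_permutation, of c] by (simp add: stored_points_def upt_conv_Cons)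

text \<open>
  After \<open>k + 1\<close> points of the cycle, the points not obtained by a query are those at the multiples of
  \<open>\<alpha>\<close> in \<open>{0..k}\<close>; together with the queries made they account for all points found.
\<close>

lemma unpack5_cycle:
  assumes "k < period p c"
    and "reaches (unpack_step5 \<alpha> (p, q)) x
      (xs @ [c], 1, period p c # M, tl (stored_points \<alpha> p c) @ C', K)"
  shows "\<exists>L. L + length (filter (\<lambda>k. \<alpha> dvd k) [0..<Suc k]) = Suc (K + k) \<and>
    reaches (unpack_step5 \<alpha> (p, q)) x
      (xs @ traverse p c (Suc k), Suc k, period p c # M,
       map (\<lambda>k. (p ^^ k) c) (filter (\<lambda>k. \<alpha> dvd k) [Suc k..<period p c]) @ C', L)"
  using assms(1)
proof (induction k)
  case 0
  then show ?case using assms(2) by (simp add: traverse_1 stored_points_Cons)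
next
  case (Suc k)
  then obtain L where L: "L + length (filter (\<lambda>k. \<alpha> dvd k) [0..<Suc k]) = Suc (K + k)"
    and r: "reaches (unpack_step5 \<alpha> (p, q)) x
      (xs @ traverse p c (Suc k), Suc k, period p c # M,
       map (\<lambda>k. (p ^^ k) c) (filter (\<lambda>k. \<alpha> dvd k) [Suc k..<period p c]) @ C', L)"
    by auto
  have upt: "[Suc k..<period p c] = Suc k # [Suc (Suc k)..<period p c]"
    using Suc.prems by (simp add: upt_conv_Cons)
  show ?case
  proof (cases "\<alpha> dvd Suc k")
    case True
    show ?thesis using Suc.prems L True
      by (intro exI[of _ L] conjI reaches_step[OF r])
        (simp_all add: unpack_step5_def traverse_Suc upt split: if_splits)
  next
    case False
    show ?thesis using Suc.prems L False last_append_traverse[of "Suc k" p xs c]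
      by (intro exI[of _ "L + 1"] conjI reaches_step[OF r])
        (simp_all add: unpack_step5_def traverse_Suc upt split: if_splits)
  qed
qed

lemma unpack5_full_cycle:
  assumes "reaches (unpack_step5 \<alpha> (p, q)) x
      (xs @ [c], 1, period p c # M, tl (stored_points \<alpha> p c) @ C', K)"
  shows "\<exists>L. L + length (stored_points \<alpha> p c) = K + period p c \<and>
    reaches (unpack_step5 \<alpha> (p, q)) x
      (xs @ full_cycle p c, period p c, period p c # M, C', L)"
  using unpack5_cycle[of "period p c - 1" c, OF _ assms] period_pos[OF p_permutation, of c]
  by (simp add: full_cycle_def stored_points_def)

lemma unpack5_reaches:
  "grows C F \<Longrightarrow> \<exists>L. L + length (concat (map (stored_points \<alpha> p) C)) = length (walk p C) \<and>
     reaches (unpack_step5 \<alpha> (p, q))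
       ([s], 1, map (period p) C @ M', tl (concat (map (stored_points \<alpha> p) C)) @ C', 0)
       (walk p C, period p (last C), period p (last C) # M', C', L)"
proof (induction arbitrary: M' C' rule: grows.induct)
  case seed_cycle
  show ?case using unpack5_full_cycle[of \<alpha> _ "[]" s M' C' 0, OF reaches_refl]
    by (simp add: walk_single)
next
  case (founded_cycle C F f)
  let ?c = "q (walk p C ! (f - 1))"
  let ?init = "([s], 1, map (period p) C @ period p ?c # M',
    tl (concat (map (stored_points \<alpha> p) C)) @ stored_points \<alpha> p ?c @ C', 0)"
  obtain L where L: "L + length (concat (map (stored_points \<alpha> p) C)) = length (walk p C)"
    and r: "reaches (unpack_step5 \<alpha> (p, q)) ?init
      (walk p C, period p (last C), period p (last C) # period p ?c # M', stored_points \<alpha> p ?c @ C', L)"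
    using founded_cycle.IH by blast
  have "hd (stored_points \<alpha> p ?c @ C') = ?c" "tl (stored_points \<alpha> p ?c @ C') = tl (stored_points \<alpha> p ?c) @ C'"
    by (simp_all add: stored_points_Cons)
  then have "reaches (unpack_step5 \<alpha> (p, q)) ?init
      (walk p C @ [?c], 1, period p ?c # M', tl (stored_points \<alpha> p ?c) @ C', L)"
    by (intro reaches_step[OF r]) (simp add: unpack_step5_def)
  from unpack5_full_cycle[OF this] L
  obtain L' where L': "L' + length (stored_points \<alpha> p ?c) = L + period p ?c"
    and r': "reaches (unpack_step5 \<alpha> (p, q)) ?init
      (walk p C @ full_cycle p ?c, period p ?c, period p ?c # M', C', L')" by blast
  have "concat (map (stored_points \<alpha> p) C) \<noteq> []"
    using grows_nonempty[OF founded_cycle.hyps(1)] by (cases C) (auto simp: stored_points_Cons)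
  then show ?case using L L' r' by (intro exI[of _ L']) (simp add: tl_append2)
qed

text \<open>
  With \<open>\<alpha> = 0\<close> the only multiple of \<open>\<alpha>\<close> is \<open>0\<close>, so just the first point of each cycle is stored, and
  type V degenerates to type IV.  The results for type IV are obtained in this way.
\<close>

lemma stored_points_0: "stored_points 0 p c = [c]"
proof -
  have "filter (\<lambda>k. 0 dvd k) [1..<period p c] = []" by (auto simp: filter_empty_conv)
  then show ?thesis by (simp add: stored_points_Cons)
qed

lemma reaches_step4_of_step5:
  assumes "reaches (unpack_step5 0 \<sigma>) x y" "0 < fst (snd x)"
  shows "reaches (unpack_step4 \<sigma>) x y"
proof -
  from assms(1) obtain n where n: "(unpack_step5 0 \<sigma> ^^ n) x = y" by (auto simp: reaches_def)
  have "(unpack_step4 \<sigma> ^^ n) x = (unpack_step5 0 \<sigma> ^^ n) x \<and>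
      0 < fst (snd ((unpack_step5 0 \<sigma> ^^ n) x))" for n
  proof (induction n)
    case (Suc n)
    then show ?case
      by (cases "(unpack_step5 0 \<sigma> ^^ n) x")
        (auto simp: unpack_step4_def unpack_step5_def)
  qed (use assms(2) in simp)
  then show ?thesis using n by (auto simp: reaches_def)
qed

lemma unpack4_reaches:
  "grows C F \<Longrightarrow> \<exists>L. L + length C = length (walk p C) \<and>
     reaches (unpack_step4 (p, q)) ([s], 1, map (period p) C, tl C, 0)
       (walk p C, period p (last C), [period p (last C)], [], L)"
  using unpack5_reaches[of C F 0 "[]" "[]"] reaches_step4_of_step5[of "(p, q)"]
  by (fastforce simp: stored_points_0 cong: map_cong)

lemma hd_grows: "grows C F \<Longrightarrow> hd C = s"
proof (induction rule: grows.induct)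
  case (founded_cycle C F f)
  then show ?case using grows_nonempty[OF founded_cycle.hyps(1)] by simp
qed simp

lemma hd_stored_points_grows: "grows C F \<Longrightarrow> hd (concat (map (stored_points \<alpha> p) C)) = s"
  using hd_grows[of C F] grows_nonempty[of C F] by (cases C) (auto simp: stored_points_Cons)

end

lemma length_filter_dvd_upt:
  assumes "1 \<le> \<alpha>"
  shows "int (length (filter (\<lambda>k. \<alpha> dvd k) [0..<m])) = \<lceil>real m / real \<alpha>\<rceil>"
proof (induction m)
  case (Suc m)
  define a b where "a = m div \<alpha>" and "b = m mod \<alpha>"
  have m: "real m = real \<alpha> * real a + real b" and b: "b < \<alpha>"
    using assms mult_div_mod_eq[of \<alpha> m] unfolding a_def b_def 
    by (simp_all flip: of_nat_mult of_nat_add)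
  have dvd: "\<alpha> dvd m \<longleftrightarrow> b = 0" by (auto simp: b_def)
  have S: "\<lceil>real (Suc m) / real \<alpha>\<rceil> = int a + 1"
    using assms m b by (intro ceiling_unique) (auto simp: field_simps)
  have "\<lceil>real m / real \<alpha>\<rceil> = (if b = 0 then int a else int a + 1)"
    using assms m b by (intro ceiling_unique) (auto simp: field_simps)
  with S dvd Suc show ?case by simp
qed simp

lemma concat_map_if: "concat (map (\<lambda>x. if P x then [f x] else []) xs) = map f (filter P xs)"
  by (induction xs) auto

context monodromy_pair begin

text \<open>
  The terminal state of the solver determines all components of all five representations, since the
  cycle starts, their periods and the stored points are functions of the final walk.
\<close>

lemma representation_data:
  obtains C F where "grows C F" 
    "monodromy_ordering (card \<Omega>) (p, q) s = walk p C"
    "founder_indices (card \<Omega>) (p, q) s = F"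
    "cycle_minima (card \<Omega>) (p, q) s = C"
    "cycle_lengths (card \<Omega>) (p, q) s = map (period p) C"
    "\<And>\<alpha>. cycle_samples \<alpha> (card \<Omega>) (p, q) s = concat (map (stored_points \<alpha> p) C)"
    "set (walk p C) = \<Omega>" "distinct (walk p C)" "length (walk p C) = card \<Omega>"
    "distinct (map (orbit p) C)" "orbit p ` set C = cycles \<Omega> p"
    "last_founder (card \<Omega>) (p, q) s \<le> card \<Omega>"
    "unpack \<alpha> (card \<Omega>) (Rep1 s (p, q)) =
       Some (walk p C, card \<Omega> + last_founder (card \<Omega>) (p, q) s - 1)"
proof -
  obtain st C where st: "monodromy_solve (card \<Omega>) (p, q) s = Some st" and g: "grows C (founders st)"
    and S: "sols st = walk p C" "set (sols st) = \<Omega>"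
    and qs: "Suc (queries st) = card \<Omega> + (if founders st = [] then 0 else Max (set (founders st)))"
    and F: "\<forall>f\<in>set (founders st). f \<le> card \<Omega>"
    using monodromy_solve_terminates by blast
  have mo: "monodromy_ordering (card \<Omega>) (p, q) s = walk p C"
    and fi: "founder_indices (card \<Omega>) (p, q) s = founders st"
    using st S by (simp_all add: monodromy_ordering_def founder_indices_def)
  have cm: "cycle_minima (card \<Omega>) (p, q) s = C"
    using cycle_firsts_walk[OF p_permutation grows_distinct[OF g]] mo
    by (simp add: cycle_minima_def cycle_firsts_def Let_def)
  have lf: "last_founder (card \<Omega>) (p, q) s = (if founders st = [] then 0 else Max (set (founders st)))"
    using fi by (simp add: last_founder_def Let_def)
  have "length (walk p C) = card \<Omega>"
    using distinct_card[OF grows_distinct[OF g]] S by simp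
  moreover have "orbit p ` set C = cycles \<Omega> p" using orbits_eq_cycles[OF g] S by simp
  moreover have "last_founder (card \<Omega>) (p, q) s \<le> card \<Omega>" using lf F by auto
  moreover have "cycle_samples \<alpha> (card \<Omega>) (p, q) s = concat (map (stored_points \<alpha> p) C)" for \<alpha>
    using cm by (simp add: cycle_samples_def stored_points_def[abs_def] concat_map_if)
  ultimately show ?thesis
    using that[OF g mo fi cm _ _ _ grows_distinct[OF g] _ distinct_orbits_walk[OF p_permutation grows_distinct[OF g]]]
      st S cm lf qs
    by (simp add: cycle_lengths_def)
qed

end

section \<open>Storage and query counts\<close>

context monodromy_pair begin

lemma sum_list_cycle_lengths:
  assumes "distinct (map (orbit p) C)" "orbit p ` set C = cycles \<Omega> p"
  shows "(\<Sum>m\<leftarrow>map (period p) C. g m) = (\<Sum>c\<in>cycles \<Omega> p. g (card c))"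
  using assms sum_list_distinct_conv_sum_set[of "map (orbit p) C" "\<lambda>c. g (card c)"]
  by (simp add: comp_def)

lemma length_concat_stored_points:
  assumes "1 \<le> \<alpha>"
  shows "int (length (concat (map (stored_points \<alpha> p) C))) = (\<Sum>m\<leftarrow>map (period p) C. \<lceil>real m / real \<alpha>\<rceil>)"
  by (induction C) (simp_all add: stored_points_def length_filter_dvd_upt[OF assms])

lemma excess_bits_represent:
  assumes \<alpha>: "1 \<le> \<alpha>"
  defines "d \<equiv> card \<Omega>" and "r \<equiv> int (card (cycles \<Omega> p))"
    and "\<Sigma>M \<equiv> (\<Sum>m\<leftarrow>cycle_lengths (card \<Omega>) (p, q) s. \<lceil>real m / real \<alpha>\<rceil>)"
  shows "int (excess_bits pb ib (represent I \<alpha> d (p, q) s)) = int pb"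
    and "int (excess_bits pb ib (represent II \<alpha> d (p, q) s)) = int pb + (r - 1) * int ib"
    and "int (excess_bits pb ib (represent III \<alpha> d (p, q) s)) = int pb + (2 * r - 1) * int ib"
    and "int (excess_bits pb ib (represent IV \<alpha> d (p, q) s)) = r * int pb + (2 * r - 1) * int ib"
    and "int (excess_bits pb ib (represent V \<alpha> d (p, q) s)) = \<Sigma>M * int pb + (2 * r - 1) * int ib"
proof -
  obtain C F where D: "grows C F" "founder_indices d (p, q) s = F" "cycle_minima d (p, q) s = C"
    "cycle_lengths d (p, q) s = map (period p) C"
    "cycle_samples \<alpha> d (p, q) s = concat (map (stored_points \<alpha> p) C)"
    "distinct (map (orbit p) C)" "orbit p ` set C = cycles \<Omega> p"
    by (rule representation_data[of \<alpha>], rule that[unfolded d_def]; (assumption | simp))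
  have r: "int (length C) = r" unfolding r_def
    using D(7) distinct_card[OF D(6)] by simp
  then have rF': "r = int (length F) + 1" using grows_length[OF D(1)] by simp
  have S: "int (length (concat (map (stored_points \<alpha> p) C))) = \<Sigma>M"
    unfolding \<Sigma>M_def D(4)[unfolded d_def] by (rule length_concat_stored_points[OF \<alpha>])
  show "int (excess_bits pb ib (represent I \<alpha> d (p, q) s)) = int pb"
    and "int (excess_bits pb ib (represent II \<alpha> d (p, q) s)) = int pb + (r - 1) * int ib"
    and "int (excess_bits pb ib (represent III \<alpha> d (p, q) s)) = int pb + (2 * r - 1) * int ib"
    and "int (excess_bits pb ib (represent IV \<alpha> d (p, q) s)) = r * int pb + (2 * r - 1) * int ib"
    and "int (excess_bits pb ib (represent V \<alpha> d (p, q) s)) = \<Sigma>M * int pb + (2 * r - 1) * int ib"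
    using D(2-5) r rF' S by (simp_all add: algebra_simps del: length_concat)
qed

text \<open>
  Counting queries: type I makes one query of \<open>\<sigma>\<^sub>0\<close> for every point but the last and one of \<open>\<sigma>\<^sub>1\<close> for
  every index up to the last founder; type II needs only the founders among the latter; type III asks
  once per point besides the seed; types IV and V ask once per point that is not stored.
\<close>

lemma unpack_represent:
  assumes \<alpha>: "1 \<le> \<alpha>"
  defines "d \<equiv> card \<Omega>" and "r \<equiv> int (card (cycles \<Omega> p))"
    and "\<Sigma>M \<equiv> (\<Sum>m\<leftarrow>cycle_lengths (card \<Omega>) (p, q) s. \<lceil>real m / real \<alpha>\<rceil>)"
    and "S \<equiv> monodromy_ordering (card \<Omega>) (p, q) s"
  shows "set S = \<Omega>" and "distinct S"
    and "unpack \<alpha> d (represent T \<alpha> d (p, q) s) = Some (S, unpack_queries T \<alpha> d (p, q) s)"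
    and "int (unpack_queries I \<alpha> d (p, q) s) = int d + int (last_founder d (p, q) s) - 1"
    and "int (unpack_queries II \<alpha> d (p, q) s) = int d + r - 2"
    and "int (unpack_queries III \<alpha> d (p, q) s) = int d - 1"
    and "int (unpack_queries IV \<alpha> d (p, q) s) = int d - r"
    and "int (unpack_queries V \<alpha> d (p, q) s) = int d - \<Sigma>M"
    and "r \<le> int d" and "last_founder d (p, q) s \<le> d" and "0 \<le> \<Sigma>M"
proof -
  obtain C F where D: "grows C F" "S = walk p C" "founder_indices d (p, q) s = F"
    "cycle_minima d (p, q) s = C"
    "cycle_lengths d (p, q) s = map (period p) C"
    "cycle_samples \<alpha> d (p, q) s = concat (map (stored_points \<alpha> p) C)"
    "set (walk p C) = \<Omega>" "distinct (walk p C)" "length (walk p C) = d"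
    "distinct (map (orbit p) C)" "orbit p ` set C = cycles \<Omega> p"
    "last_founder d (p, q) s \<le> d"
    "unpack \<alpha> d (Rep1 s (p, q)) = Some (walk p C, d + last_founder d (p, q) s - 1)"
    by (rule representation_data[of \<alpha>], rule that[unfolded d_def S_def]; (assumption | simp))
  have d: "0 < d" using finite_pts seed by (auto simp: d_def card_gt_0_iff)
  have r: "int (length C) = r" unfolding r_def
    using D(11) distinct_card[OF D(10)] by simp
  then have rF: "int (length F) = r - 1" using grows_length[OF D(1)] by simp
  have \<Sigma>: "int (length (concat (map (stored_points \<alpha> p) C))) = \<Sigma>M"
    unfolding \<Sigma>M_def D(5)[unfolded d_def] by (rule length_concat_stored_points[OF \<alpha>])
  obtain K2 where K2: "Suc K2 = length (walk p C) + length F"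
    "reaches (unpack_step2 (p, q)) ([s], F, 0) (walk p C, [], K2)"
    using unpack2_reaches[OF D(1), of "[]"] by auto
  obtain K3 where K3: "Suc K3 = length (walk p C)"
    "reaches (unpack_step3 (p, q)) ([s], 1, map (period p) C, F, 0)
       (walk p C, period p (last C), [period p (last C)], [], K3)"
    using unpack3_reaches[OF D(1), of "[]" "[]"] by auto
  obtain K4 where K4: "K4 + length C = length (walk p C)"
    "reaches (unpack_step4 (p, q)) ([s], 1, map (period p) C, tl C, 0)
       (walk p C, period p (last C), [period p (last C)], [], K4)"
    using unpack4_reaches[OF D(1)] by auto
  obtain K5 where K5: "K5 + length (concat (map (stored_points \<alpha> p) C)) = length (walk p C)"
    "reaches (unpack_step5 \<alpha> (p, q)) ([s], 1, map (period p) C, tl (concat (map (stored_points \<alpha> p) C)), 0)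
       (walk p C, period p (last C), [period p (last C)], [], K5)"
    using unpack5_reaches[OF D(1), of \<alpha> "[]" "[]"] by auto
  have W2: "unpack \<alpha> d (represent II \<alpha> d (p, q) s) = Some (S, K2)"
    using while_option_reaches[OF K2(2), of d] D
    by (simp add: unpack_step2_def Let_def split: prod.splits)
  have W3: "unpack \<alpha> d (represent III \<alpha> d (p, q) s) = Some (S, K3)"
    using while_option_reaches[OF K3(2), of d] D
    by (simp add: unpack_step3_def Let_def split: prod.splits)
  have W4: "unpack \<alpha> d (represent IV \<alpha> d (p, q) s) = Some (S, K4)"
    using while_option_reaches[OF K4(2), of d] D hd_grows[OF D(1)]
    by (simp add: unpack_step4_def Let_def split: prod.splits)
  have W5: "unpack \<alpha> d (represent V \<alpha> d (p, q) s) = Some (S, K5)"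
    using while_option_reaches[OF K5(2), of d] D hd_stored_points_grows[OF D(1), of \<alpha>]
    by (simp add: unpack_step5_def Let_def split: prod.splits)
  have W1: "unpack \<alpha> d (represent I \<alpha> d (p, q) s) = Some (S, d + last_founder d (p, q) s - 1)"
    using D by simp
  note W = W1 W2 W3 W4 W5
  show "set S = \<Omega>" and "distinct S" using D by simp_all
  show "unpack \<alpha> d (represent T \<alpha> d (p, q) s) = Some (S, unpack_queries T \<alpha> d (p, q) s)"
    unfolding unpack_queries_def by (cases T) (simp_all only: W option.sel snd_conv)
  show "int (unpack_queries I \<alpha> d (p, q) s) = int d + int (last_founder d (p, q) s) - 1"
    unfolding unpack_queries_def W using d by simp
  show "int (unpack_queries II \<alpha> d (p, q) s) = int d + r - 2"
    unfolding unpack_queries_def W using K2(1) D(9) rF by simp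
  show "int (unpack_queries III \<alpha> d (p, q) s) = int d - 1"
    unfolding unpack_queries_def W using K3(1) D(9) by simp
  show "int (unpack_queries IV \<alpha> d (p, q) s) = int d - r"
    unfolding unpack_queries_def W using K4(1) D(9) r by simp
  show "int (unpack_queries V \<alpha> d (p, q) s) = int d - \<Sigma>M"
    unfolding unpack_queries_def W using K5(1) D(9) \<Sigma> by (simp del: length_concat)
  show "r \<le> int d" using K4(1) D(9) r by simp
  show "last_founder d (p, q) s \<le> d" using D by simp
  show "0 \<le> \<Sigma>M" using \<Sigma> by linarith
qed

lemma real_sum_ceiling_cycle_lengths:
  "real_of_int (\<Sum>m\<leftarrow>cycle_lengths (card \<Omega>) (p, q) s. \<lceil>real m / real \<alpha>\<rceil>) =
    (\<Sum>c\<in>cycles \<Omega> p. real_of_int \<lceil>real (card c) / real \<alpha>\<rceil>)"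
proof (rule representation_data)
  fix C
  assume C: "cycle_lengths (card \<Omega>) (p, q) s = map (period p) C"
    "distinct (map (orbit p) C)" "orbit p ` set C = cycles \<Omega> p"
  show ?thesis
    unfolding C(1) sum_list_cycle_lengths[OF C(2,3)] by (rule of_int_sum)
qed

end

section \<open>Transitive groups of permutations\<close>

lemma group_perm_group: "group (perm_group \<Omega>)"
proof (rule groupI)
  fix x assume "x \<in> carrier (perm_group \<Omega>)"
  then show "\<exists>y\<in>carrier (perm_group \<Omega>). y \<otimes>\<^bsub>perm_group \<Omega>\<^esub> x = \<one>\<^bsub>perm_group \<Omega>\<^esub>"
    by (intro bexI[of _ "inv_into UNIV x"]) (auto simp: perm_group_def permutes_inv permutes_inv_o)
qed (auto simp: perm_group_def permutes_compose permutes_id comp_assoc)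

text \<open>
  A permutation that maps a finite set into itself maps it onto itself, so the inverses of the
  generators preserve the set too.
\<close>

lemma generate_perm_group_image_subset:
  assumes "g \<in> generate (perm_group \<Omega>) H" "\<And>h. h \<in> H \<Longrightarrow> h permutes \<Omega> \<and> h ` S \<subseteq> S" "finite S"
  shows "g ` S \<subseteq> S"
  using assms(1)
proof (induction rule: generate.induct)
  case (inv h)
  let ?k = "inv\<^bsub>perm_group \<Omega>\<^esub> h"
  have h: "h \<in> carrier (perm_group \<Omega>)" using assms(2)[OF inv] by (simp add: perm_group_def)
  have "?k \<circ> h = id"
    using group.l_inv[OF group_perm_group h] by (simp add: perm_group_def)
  moreover have "h ` S = S"
    using assms(2)[OF inv] assms(3) permutes_inj[of h \<Omega>]
    by (intro endo_inj_surj) (auto intro: inj_on_subset)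
  ultimately show ?case by (metis image_comp image_id id_apply order_refl)
next
  case (eng h1 h2)
  then show ?case by (auto simp: perm_group_def)
next
  case one
  then show ?case by (simp add: perm_group_def)
qed (use assms(2) in blast)

lemma monodromy_pair_of_data:
  assumes "monodromy_data n \<Omega> \<sigma> s"
  shows "monodromy_pair \<Omega> (fst \<sigma>) (snd \<sigma>) s"
proof
  fix S assume S: "S \<subseteq> \<Omega>" "s \<in> S" "fst \<sigma> ` S \<subseteq> S" "snd \<sigma> ` S \<subseteq> S"
  have "finite S" using S(1) assms finite_subset by (auto simp: monodromy_data_def)
  have "y \<in> S" if "y \<in> \<Omega>" for y
  proof -
    have "s \<in> \<Omega>" and "generates_transitive_group \<Omega> \<sigma>"
      using assms by (simp_all add: monodromy_data_def)
    from this(2)[unfolded generates_transitive_group_def, rule_format, OF this(1) that]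
    obtain g where g: "g \<in> generate (perm_group \<Omega>) {fst \<sigma>, snd \<sigma>}" "g s = y" ..
    have "g ` S \<subseteq> S"
      by (rule generate_perm_group_image_subset[OF g(1) _ \<open>finite S\<close>])
        (use assms S in \<open>auto simp: monodromy_data_def\<close>)
    then show ?thesis using imageI[OF S(2), of g] g(2) by auto
  qed
  then show "S = \<Omega>" using S by blast
qed (use assms in \<open>auto simp: monodromy_data_def\<close>)

section \<open>Expected storage and asymptotics\<close>

lemma random_monodromy_dataD:
  assumes "random_monodromy_data n \<Omega> P s"
  shows "finite \<Omega>" "\<Omega> \<noteq> {}" "1 \<le> n"
proof -
  obtain \<sigma> where "\<sigma> \<in> set_pmf P" using set_pmf_not_empty[of P] by blast
  then have "monodromy_data n \<Omega> \<sigma> s" using assms by (simp add: random_monodromy_data_def)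
  then show "finite \<Omega>" "\<Omega> \<noteq> {}" "1 \<le> n" by (auto simp: monodromy_data_def)
qed

text \<open>
  The size of a representation depends on the oracles only through \<open>\<sigma>\<^sub>0\<close>, so its expectation is governed
  by the first marginal alone, whatever the coupling with \<open>\<sigma>\<^sub>1\<close>.
\<close>

lemma expected_bits_eq:
  assumes "random_monodromy_data n \<Omega> P s"
    and "\<And>\<sigma>. monodromy_data n \<Omega> \<sigma> s \<Longrightarrow>
      real (excess_bits (point_bits \<rho>R n) \<rho>N (represent T \<alpha> (card \<Omega>) \<sigma> s)) = h (fst \<sigma>)"
  shows "expected_bits \<rho>R \<rho>N T \<alpha> n \<Omega> P s = measure_pmf.expectation (uniform_perm \<Omega>) h"
proof -
  have "expected_bits \<rho>R \<rho>N T \<alpha> n \<Omega> P s = measure_pmf.expectation P (\<lambda>\<sigma>. h (fst \<sigma>))"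
    unfolding expected_bits_def using assms
    by (intro integral_cong_AE) (auto simp: AE_measure_pmf_iff random_monodromy_data_def)
  also have "\<dots> = measure_pmf.expectation (map_pmf fst P) h" by simp
  also have "map_pmf fst P = uniform_perm \<Omega>"
    using assms(1) by (simp only: random_monodromy_data_def)
  finally show ?thesis .
qed

lemma expectation_affine_in_cycles:
  assumes "finite \<Omega>" "\<And>p. f p = u + v * real (card (cycles \<Omega> p))"
  shows "measure_pmf.expectation (uniform_perm \<Omega>) f = u + v * harm (card \<Omega>)"
  unfolding assms(2) by (rule expectation_card_cycles[OF assms(1)])

lemma expectation_bits:
  fixes \<rho>C \<rho>N :: real
  assumes "finite \<Omega>"
  defines "r \<equiv> \<lambda>p. real (card (cycles \<Omega> p))"
    and "E \<equiv> measure_pmf.expectation (uniform_perm \<Omega>)" and "H \<equiv> harm (card \<Omega>)"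
  shows "E (\<lambda>p. \<rho>C + (r p - 1) * \<rho>N) = \<rho>C + (H - 1) * \<rho>N"
    and "E (\<lambda>p. \<rho>C + (2 * r p - 1) * \<rho>N) = \<rho>C + (2 * H - 1) * \<rho>N"
    and "E (\<lambda>p. r p * \<rho>C + (2 * r p - 1) * \<rho>N) = H * \<rho>C + (2 * H - 1) * \<rho>N"
proof -
  show "E (\<lambda>p. \<rho>C + (r p - 1) * \<rho>N) = \<rho>C + (H - 1) * \<rho>N"
    unfolding E_def H_def r_def
    by (subst expectation_affine_in_cycles[OF assms(1), of _ "\<rho>C - \<rho>N" \<rho>N])
      (simp_all add: algebra_simps)
  show "E (\<lambda>p. \<rho>C + (2 * r p - 1) * \<rho>N) = \<rho>C + (2 * H - 1) * \<rho>N"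
    unfolding E_def H_def r_def
    by (subst expectation_affine_in_cycles[OF assms(1), of _ "\<rho>C - \<rho>N" "2 * \<rho>N"])
      (simp_all add: algebra_simps)
  show "E (\<lambda>p. r p * \<rho>C + (2 * r p - 1) * \<rho>N) = H * \<rho>C + (2 * H - 1) * \<rho>N"
    unfolding E_def H_def r_def
    by (subst expectation_affine_in_cycles[OF assms(1), of _ "- \<rho>N" "\<rho>C + 2 * \<rho>N"])
      (simp_all add: algebra_simps)
qed

lemma expected_bits_formulas:
  fixes \<rho>R \<rho>N :: nat
  assumes R: "random_monodromy_data n \<Omega> P s" and "1 \<le> \<alpha>" and "0 < \<rho>R"
  defines "d \<equiv> card \<Omega>" and "\<rho>C \<equiv> real (point_bits \<rho>R n)"
    and "E \<equiv> \<lambda>T. expected_bits \<rho>R \<rho>N T \<alpha> n \<Omega> P s"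
  shows "E I = \<rho>C"
    and "E II = \<rho>C + (harm d - 1) * real \<rho>N"
    and "E III = \<rho>C + (2 * harm d - 1) * real \<rho>N"
    and "E IV = harm d * \<rho>C + (2 * harm d - 1) * real \<rho>N"
    and "E V < (real d / real \<alpha> + harm d) * \<rho>C + (2 * harm d - 1) * real \<rho>N"
proof -
  note RD = random_monodromy_dataD[OF R]
  let ?r = "\<lambda>p. real (card (cycles \<Omega> p))"
  let ?bits = "\<lambda>T \<sigma>. excess_bits (point_bits \<rho>R n) \<rho>N (represent T \<alpha> (card \<Omega>) \<sigma> s)"
  have bits: "real (?bits I \<sigma>) = \<rho>C"
    "real (?bits II \<sigma>) = \<rho>C + (?r (fst \<sigma>) - 1) * \<rho>N"
    "real (?bits III \<sigma>) = \<rho>C + (2 * ?r (fst \<sigma>) - 1) * \<rho>N"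
    "real (?bits IV \<sigma>) = ?r (fst \<sigma>) * \<rho>C + (2 * ?r (fst \<sigma>) - 1) * \<rho>N"
    "real (?bits V \<sigma>) = (\<Sum>c\<in>cycles \<Omega> (fst \<sigma>). real_of_int \<lceil>real (card c) / real \<alpha>\<rceil>) * \<rho>C
      + (2 * ?r (fst \<sigma>) - 1) * \<rho>N"
    if "monodromy_data n \<Omega> \<sigma> s" for \<sigma>
  proof -
    interpret monodromy_pair \<Omega> "fst \<sigma>" "snd \<sigma>" s using that by (rule monodromy_pair_of_data)
    note B = excess_bits_represent[OF assms(2), of "point_bits \<rho>R n" \<rho>N, unfolded prod.collapse,
        THEN arg_cong[where f = real_of_int]]
    show "real (?bits I \<sigma>) = \<rho>C"
      "real (?bits II \<sigma>) = \<rho>C + (?r (fst \<sigma>) - 1) * \<rho>N"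
      "real (?bits III \<sigma>) = \<rho>C + (2 * ?r (fst \<sigma>) - 1) * \<rho>N"
      "real (?bits IV \<sigma>) = ?r (fst \<sigma>) * \<rho>C + (2 * ?r (fst \<sigma>) - 1) * \<rho>N"
      "real (?bits V \<sigma>) = (\<Sum>c\<in>cycles \<Omega> (fst \<sigma>). real_of_int \<lceil>real (card c) / real \<alpha>\<rceil>) * \<rho>C
        + (2 * ?r (fst \<sigma>) - 1) * \<rho>N"
      unfolding \<rho>C_def real_sum_ceiling_cycle_lengths[unfolded prod.collapse, symmetric]
      using B by (simp_all only: of_int_of_nat_eq of_int_add of_int_diff of_int_mult of_int_1
          of_int_numeral)
  qed
  note eq = expected_bits_eq[OF R, of \<rho>R \<rho>N _ \<alpha>]
  show "E I = \<rho>C" unfolding E_def by (subst eq[OF bits(1)]) simp_all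
  show "E II = \<rho>C + (harm d - 1) * real \<rho>N" unfolding E_def d_def
    by (subst eq[OF bits(2)]) (simp_all add: expectation_bits[OF RD(1)])
  show "E III = \<rho>C + (2 * harm d - 1) * real \<rho>N" unfolding E_def d_def
    by (subst eq[OF bits(3)]) (simp_all add: expectation_bits[OF RD(1)])
  show "E IV = harm d * \<rho>C + (2 * harm d - 1) * real \<rho>N" unfolding E_def d_def
    by (subst eq[OF bits(4)]) (simp_all add: expectation_bits[OF RD(1)])
  have "0 < \<rho>C" using RD(3) assms(3) by (simp add: \<rho>C_def point_bits_def)
  then show "E V < (real d / real \<alpha> + harm d) * \<rho>C + (2 * harm d - 1) * real \<rho>N"
    unfolding E_def d_def by (subst eq[OF bits(5)]) (simp_all add: expectation_type5_less[OF RD(1,2)])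
qed

text \<open>
  For \<open>d \<ge> 2\<close> the additive constant can be absorbed into a multiple of \<open>ln d\<close>, as the bounds for types
  IV and V, which have no other term to absorb it, require.
\<close>

lemma harm_bounds:
  assumes "2 \<le> d"
  shows "1 \<le> (harm d :: real)" "harm d \<le> 1 + ln (real d)" "harm d \<le> 3 * ln (real d)"
proof -
  show 1: "harm d \<le> 1 + ln (real d)"
    using euler_mascheroni_sequence_decreasing[of 1 d] assms by (simp add: harm_expand)
  show "1 \<le> (harm d :: real)" using harm_mono[of 1 d] assms by (simp add: harm_expand)
  have "1 / 2 \<le> ln (2 :: real)" using ln2_ge_two_thirds by simp
  also have "\<dots> \<le> ln (real d)" using assms by simp
  finally show "harm d \<le> 3 * ln (real d)" using 1 by linarith
qed

lemma expected_bits_bounds: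
  fixes \<rho>R \<rho>N :: nat
  assumes R: "random_monodromy_data n \<Omega> P s" and "1 \<le> \<alpha>" and "0 < \<rho>R" and d: "2 \<le> card \<Omega>"
  defines "L \<equiv> ln (real (card \<Omega>))" 
    and "E \<equiv> \<lambda>T. expected_bits \<rho>R \<rho>N T \<alpha> n \<Omega> P s"
  shows "E I \<le> 2 * real \<rho>R * real n"
    and "E II \<le> (2 * real \<rho>R + real \<rho>N) * max (real n) L"
    and "E III \<le> (2 * real \<rho>R + 3 * real \<rho>N) * max (real n) L"
    and "E IV \<le> (6 * real \<rho>R + 6 * real \<rho>N) * (real n * L)"
    and "E V \<le> (8 * real \<rho>R + 6 * real \<rho>N) * max (real n * (real (card \<Omega>) / real \<alpha>)) (real n * L)"
proof -
  note F = expected_bits_formulas[OF assms(1-3), of \<rho>N]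
  let ?R = "real \<rho>R" and ?N = "real \<rho>N" and ?n = "real n" and ?H = "harm (card \<Omega>) :: real"
  have n: "1 \<le> ?n" using random_monodromy_dataD[OF R] by simp
  have H: "1 \<le> ?H" "?H \<le> 1 + L" "?H \<le> 3 * L" using harm_bounds[OF d] by (simp_all add: L_def)
  have C: "real (point_bits \<rho>R n) = 2 * ?R * ?n" by (simp add: point_bits_def)
  show "E I \<le> 2 * ?R * ?n" using F(1) C by (simp add: E_def)
  let ?m = "max ?n L"
  have m: "2 * ?R * ?n \<le> 2 * ?R * ?m" by (intro mult_left_mono) auto
  have "(?H - 1) * ?N \<le> ?m * ?N" using H by (intro mult_right_mono) auto
  then show "E II \<le> (2 * ?R + ?N) * ?m" using F(2) m C by (simp add: E_def algebra_simps)
  have "(2 * ?H - 1) * ?N \<le> (3 * ?m) * ?N" using H n by (intro mult_right_mono) auto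
  then show "E III \<le> (2 * ?R + 3 * ?N) * ?m" using F(3) m C by (simp add: E_def algebra_simps)
  have L: "0 \<le> L" using H by linarith
  then have "L \<le> ?n * L" using n by (simp add: mult_le_cancel_right1)
  then have "2 * ?H - 1 \<le> 6 * (?n * L)" using H by linarith
  then have i: "(2 * ?H - 1) * ?N \<le> 6 * (?n * L) * ?N" by (intro mult_right_mono) auto
  have j: "?H * (2 * ?R * ?n) \<le> 3 * L * (2 * ?R * ?n)" using H by (intro mult_right_mono) auto
  show "E IV \<le> (6 * ?R + 6 * ?N) * (?n * L)" using F(4) C i j by (simp add: E_def algebra_simps)
  let ?M = "max (?n * (real (card \<Omega>) / real \<alpha>)) (?n * L)"
  have "(2 * ?R) * (?n * (real (card \<Omega>) / real \<alpha>)) \<le> (2 * ?R) * ?M" by (intro mult_left_mono) auto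
  moreover have "(6 * ?R + 6 * ?N) * (?n * L) \<le> (6 * ?R + 6 * ?N) * ?M" by (intro mult_left_mono) auto
  ultimately show "E V \<le> (8 * ?R + 6 * ?N) * ?M"
    using F(5) C i j by (simp add: E_def algebra_simps)
qed

lemma expected_bits_nonneg: "0 \<le> expected_bits \<rho>R \<rho>N T \<alpha> n \<Omega> P s"
  unfolding expected_bits_def by (rule integral_nonneg_AE) simp

lemma unpack_queries_le:
  assumes "monodromy_data n \<Omega> \<sigma> s" "1 \<le> \<alpha>"
  shows "real (unpack_queries T \<alpha> (card \<Omega>) \<sigma> s) \<le> 2 * real (card \<Omega>)"
proof -
  interpret monodromy_pair \<Omega> "fst \<sigma>" "snd \<sigma>" s using assms(1) by (rule monodromy_pair_of_data)
  have "unpack_queries T \<alpha> (card \<Omega>) \<sigma> s \<le> 2 * card \<Omega>"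
    using unpack_represent(4-)[OF assms(2), unfolded prod.collapse] by (cases T; hypsubst; linarith)
  then show ?thesis by linarith
qed


theorem theorem1:
  fixes \<rho>R \<rho>N :: nat
  assumes "\<rho>R > 0" and "\<rho>N > 0"
  shows
   "(\<forall>n \<Omega> \<sigma> s (\<alpha>::nat). monodromy_data n \<Omega> \<sigma> s \<and> \<alpha> \<ge> 1 \<longrightarrow>
      (let d = card \<Omega>;
           r = int (card (cycles \<Omega> (fst \<sigma>)));
           \<Sigma>M = (\<Sum>m\<leftarrow>cycle_lengths d \<sigma> s. \<lceil>real m / real \<alpha>\<rceil>);
           \<rho>C = int (point_bits \<rho>R n);
           bits = (\<lambda>T. int (excess_bits (point_bits \<rho>R n) \<rho>N (represent T \<alpha> d \<sigma> s)));
           time = (\<lambda>T. int (unpack_queries T \<alpha> d \<sigma> s));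
           S = monodromy_ordering d \<sigma> s
       in
         bits I = \<rho>C \<and>
         bits II = \<rho>C + (r - 1) * int \<rho>N \<and>
         bits III = \<rho>C + (2 * r - 1) * int \<rho>N \<and>
         bits IV = r * \<rho>C + (2 * r - 1) * int \<rho>N \<and>
         bits V = \<Sigma>M * \<rho>C + (2 * r - 1) * int \<rho>N \<and>
         set S = \<Omega> \<and> distinct S \<and>
         (\<forall>T. unpack \<alpha> d (represent T \<alpha> d \<sigma> s) = Some (S, unpack_queries T \<alpha> d \<sigma> s)) \<and>
         time I = int d + int (last_founder d \<sigma> s) - 1 \<and>
         time II = int d + r - 2 \<and>
         time III = int d - 1 \<and>
         time IV = int d - r \<and>
         time V = int d - \<Sigma>M)) \<and>
    (\<forall>n \<Omega> P s (\<alpha>::nat). random_monodromy_data n \<Omega> P s \<and> \<alpha> \<ge> 1 \<longrightarrow>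
      (let d = card \<Omega>;
           \<rho>C = real (point_bits \<rho>R n);
           E = (\<lambda>T. expected_bits \<rho>R \<rho>N T \<alpha> n \<Omega> P s)
       in
         E I = \<rho>C \<and>
         E II = \<rho>C + (harm d - 1) * real \<rho>N \<and>
         E III = \<rho>C + (2 * harm d - 1) * real \<rho>N \<and>
         E IV = harm d * \<rho>C + (2 * harm d - 1) * real \<rho>N \<and>
         E V < (real d / real \<alpha> + harm d) * \<rho>C + (2 * harm d - 1) * real \<rho>N)) \<and>
    (\<forall>n (\<Omega> :: complex Matrix.vec set) (\<alpha>::nat).
      n \<ge> 1 \<and> finite \<Omega> \<and> \<Omega> \<noteq> {} \<and> \<Omega> \<subseteq> carrier_vec n \<and> \<alpha> \<ge> 1 \<longrightarrow>
      (let d = card \<Omega>;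
           \<rho>C = real (point_bits \<rho>R n);
           r = (\<lambda>p. real (card (cycles \<Omega> p)));
           E = measure_pmf.expectation (uniform_perm \<Omega>)
       in
         E (\<lambda>p. \<rho>C) = \<rho>C \<and>
         E (\<lambda>p. \<rho>C + (r p - 1) * real \<rho>N) = \<rho>C + (harm d - 1) * real \<rho>N \<and>
         E (\<lambda>p. \<rho>C + (2 * r p - 1) * real \<rho>N) = \<rho>C + (2 * harm d - 1) * real \<rho>N \<and>
         E (\<lambda>p. r p * \<rho>C + (2 * r p - 1) * real \<rho>N)
           = harm d * \<rho>C + (2 * harm d - 1) * real \<rho>N \<and>
         E (\<lambda>p. (\<Sum>c\<in>cycles \<Omega> p. real_of_int \<lceil>real (card c) / real \<alpha>\<rceil>) * \<rho>C
                 + (2 * r p - 1) * real \<rho>N)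
           < (real d / real \<alpha> + harm d) * \<rho>C + (2 * harm d - 1) * real \<rho>N)) \<and>
    (let A = {(n, \<Omega>, P, s, \<alpha>::nat). random_monodromy_data n \<Omega> P s \<and> card \<Omega> \<ge> 2 \<and> \<alpha> \<ge> 1};
         E = (\<lambda>T (n, \<Omega>, P, s, \<alpha>). expected_bits \<rho>R \<rho>N T \<alpha> n \<Omega> P s)
     in
       E I \<in> O[principal A](\<lambda>(n, \<Omega>, P, s, \<alpha>). real n) \<and>
       E II \<in> O[principal A](\<lambda>(n, \<Omega>, P, s, \<alpha>). max (real n) (ln (real (card \<Omega>)))) \<and>
       E III \<in> O[principal A](\<lambda>(n, \<Omega>, P, s, \<alpha>). max (real n) (ln (real (card \<Omega>)))) \<and>
       E IV \<in> O[principal A](\<lambda>(n, \<Omega>, P, s, \<alpha>). real n * ln (real (card \<Omega>))) \<and>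
       E V \<in> O[principal A](\<lambda>(n, \<Omega>, P, s, \<alpha>).
                max (real n * (real (card \<Omega>) / real \<alpha>)) (real n * ln (real (card \<Omega>))))) \<and>
    (let B = {(n, \<Omega>, \<sigma>, s, \<alpha>::nat). monodromy_data n \<Omega> \<sigma> s \<and> card \<Omega> \<ge> 2 \<and> \<alpha> \<ge> 1}
     in \<forall>T. (\<lambda>(n, \<Omega>, \<sigma>, s, \<alpha>). real (unpack_queries T \<alpha> (card \<Omega>) \<sigma> s))
              \<in> O[principal B](\<lambda>(n, \<Omega>, \<sigma>, s, \<alpha>). real (card \<Omega>)))"
proof (intro conjI, goal_cases)
  case 1
  show ?case
  proof (intro allI impI, goal_cases)
    case (1 n \<Omega> \<sigma> s \<alpha>)
    interpret monodromy_pair \<Omega> "fst \<sigma>" "snd \<sigma>" s using 1 by (intro monodromy_pair_of_data[of n]) simp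
    from 1 have \<alpha>: "1 \<le> \<alpha>" by simp
    note B = excess_bits_represent[OF \<alpha>, of "point_bits \<rho>R n" \<rho>N, unfolded prod.collapse]
    note U = unpack_represent[OF \<alpha>, unfolded prod.collapse]
    show ?case unfolding Let_def by (intro conjI allI B U)
  qed
next
  case 2
  show ?case
  proof (intro allI impI, goal_cases)
    case (1 n \<Omega> P s \<alpha>)
    then have R: "random_monodromy_data n \<Omega> P s" and \<alpha>: "1 \<le> \<alpha>" by simp_all
    show ?case unfolding Let_def
      by (intro conjI expected_bits_formulas[OF R \<alpha> assms(1)])
  qed
next
  case 3
  show ?case
  proof (intro allI impI, goal_cases)
    case (1 n \<Omega> \<alpha>)
    then have fin: "finite \<Omega>" and "\<Omega> \<noteq> {}" and "0 < real (point_bits \<rho>R n)"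
      using assms(1) by (auto simp: point_bits_def)
    then show ?case unfolding Let_def
      by (intro conjI expectation_bits[OF fin] expectation_type5_less) simp_all
  qed
next
  case 4
  show ?case unfolding Let_def
  proof (intro conjI, goal_cases)
    case 1
    show ?case
      by (rule bigoI[where c = "2 * real \<rho>R"])
        (use assms(1) expected_bits_bounds(1) in
          \<open>auto simp: eventually_principal abs_of_nonneg[OF expected_bits_nonneg]\<close>)
  next
    case 2
    show ?case
      by (rule bigoI[where c = "2 * real \<rho>R + real \<rho>N"])
        (use assms(1) expected_bits_bounds(2) in
          \<open>auto simp: eventually_principal abs_of_nonneg[OF expected_bits_nonneg]\<close>)
  next
    case 3
    show ?case
      by (rule bigoI[where c = "2 * real \<rho>R + 3 * real \<rho>N"])
        (use assms(1) expected_bits_bounds(3) in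
          \<open>auto simp: eventually_principal abs_of_nonneg[OF expected_bits_nonneg]\<close>)
  next
    case 4
    show ?case
      by (rule bigoI[where c = "6 * real \<rho>R + 6 * real \<rho>N"])
        (use assms(1) expected_bits_bounds(4) in
          \<open>auto simp: eventually_principal abs_of_nonneg[OF expected_bits_nonneg]\<close>)
  next
    case 5
    show ?case
      by (rule bigoI[where c = "8 * real \<rho>R + 6 * real \<rho>N"])
        (use assms(1) in
          \<open>auto simp: eventually_principal abs_of_nonneg[OF expected_bits_nonneg]
            intro!: order_trans[OF expected_bits_bounds(5)] mult_left_mono\<close>)
  qed
next
  case 5
  show ?case unfolding Let_def
  proof (intro allI, goal_cases)
    case (1 T)
    show ?case
      by (rule bigoI[where c = 2])
        (auto simp: eventually_principal intro: unpack_queries_le)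
  qed
qed

end
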